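(* Let $\Gamma$ be an extended Dynkin diagram that is a tree. All eigenvalues of its (affine) Coxeter transformation are roots of unity. More precisely, the eigenvalues, listed with multiplicities, are: - $\tilde E_6$: $1,1$; $e^{\pm 2\pi i/3}$, each twice; $-1$. - $\tilde E_7$: $1,1$; $e^{\pm2\pi i/3}$; $e^{\pm\pi i/2}$; $-1,-1$. - $\tilde E_8$: $1,1$; $e^{\pm2\pi i/3}$; $e^{\pm2\pi i/5},e^{\pm4\pi i/5}$; $-1$. - $\tilde D_n$ $(n\ge4)$: $1,1$; $e^{2s\pi i/(n-2)}$ for $s=1,\dots,n-3$; $-1,-1$. - $\tilde G_{21},\tilde G_{22}$: $1,1$; $-1$. - $\tilde F_{41},\tilde F_{42}$: $1,1$; $e^{\pm2\pi i/3}$; $-1$. - $\tilde A_{11},\tilde A_{12}$: $1,1$. - $\tilde B_n,\tilde C_n,\widetilde{BC}_n$: $1,1$; $e^{2s\pi i/n}$ for $s=1,\dots,n-1$. - $\widetilde{CD}_n,\widetilde{DD}_n$: $1,1$; $e^{2s\pi i/(n-1)}$ for $s=1,\dots,n-2$; $-1$.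
   Context: The Coxeter transformation of a valued tree with Cartan matrix $K$ is the product of all simple reflections $\sigma_v(z)=z-(Kz)_v\alpha_v$, each taken once, in some order; for a tree its conjugacy class does not depend on the order. Diagram names, in Kac's notation for affine types: $\tilde D_n=D_n^{(1)}$, $\tilde E_m=E_m^{(1)}$, $\tilde G_{22}=G_2^{(1)}$, $\tilde G_{21}=D_4^{(3)}$, $\tilde F_{42}=F_4^{(1)}$, $\tilde F_{41}=E_6^{(2)}$, $\tilde A_{12}=A_1^{(1)}$, $\tilde A_{11}=A_2^{(2)}$, $\tilde C_n=C_n^{(1)}$, $\tilde B_n=D_{n+1}^{(2)}$, $\widetilde{BC}_n=A_{2n}^{(2)}$ $(n\ge2)$, $\widetilde{CD}_n=B_n^{(1)}$, $\widetilde{DD}_n=A_{2n-1}^{(2)}$ $(n\ge3)$. *)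

theory Defs
  imports
    Complex_Main
    "HOL-Combinatorics.Permutations"
    "HOL-Computational_Algebra.Fundamental_Theorem_Algebra"
    "Jordan_Normal_Form.Char_Poly"
begin

section \<open>Extended Dynkin diagrams\<close>

text \<open>
  A valued graph on the vertices \<open>0, \<dots>, N - 1\<close> is given by its Cartan matrix.
  An entry \<open>(i, j, a, b)\<close> of the edge list stands for an edge between \<open>i\<close> and \<open>j\<close> with
  \<open>K\<^sub>i\<^sub>j = -a\<close> and \<open>K\<^sub>j\<^sub>i = -b\<close>. In Kac's drawing convention the arrow of a multiple edge points
  towards \<open>i\<close> if \<open>a > 1\<close> and towards \<open>j\<close> if \<open>b > 1\<close>.
\<close>

type_synonym valued_edge = "nat \<times> nat \<times> int \<times> int"

definition cartan_of_edges :: "nat \<Rightarrow> valued_edge list \<Rightarrow> int mat" where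
  "cartan_of_edges N E = mat N N (\<lambda>(i, j). if i = j then 2 else
     - (\<Sum>(u, v, a, b) \<leftarrow> E. if (i, j) = (u, v) then a else if (i, j) = (v, u) then b else 0))"

text \<open>
  The extended Dynkin diagrams. In Kac's notation: \<open>tA n\<close> is \<open>A\<^sub>n\<^sup>(\<^sup>1\<^sup>)\<close> with \<open>n \<ge> 2\<close> (a cycle),
  \<open>tD n\<close> is \<open>D\<^sub>n\<^sup>(\<^sup>1\<^sup>)\<close>, \<open>tE6\<close>, \<open>tE7\<close>, \<open>tE8\<close> are \<open>E\<^sub>6\<^sup>(\<^sup>1\<^sup>)\<close>, \<open>E\<^sub>7\<^sup>(\<^sup>1\<^sup>)\<close>, \<open>E\<^sub>8\<^sup>(\<^sup>1\<^sup>)\<close>,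
  \<open>tG22\<close> is \<open>G\<^sub>2\<^sup>(\<^sup>1\<^sup>)\<close>, \<open>tG21\<close> is \<open>D\<^sub>4\<^sup>(\<^sup>3\<^sup>)\<close>, \<open>tF42\<close> is \<open>F\<^sub>4\<^sup>(\<^sup>1\<^sup>)\<close>, \<open>tF41\<close> is \<open>E\<^sub>6\<^sup>(\<^sup>2\<^sup>)\<close>,
  \<open>tA12\<close> is \<open>A\<^sub>1\<^sup>(\<^sup>1\<^sup>)\<close>, \<open>tA11\<close> is \<open>A\<^sub>2\<^sup>(\<^sup>2\<^sup>)\<close>, \<open>tC n\<close> is \<open>C\<^sub>n\<^sup>(\<^sup>1\<^sup>)\<close>, \<open>tB n\<close> is \<open>D\<^sub>n\<^sub>+\<^sub>1\<^sup>(\<^sup>2\<^sup>)\<close>,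
  \<open>tBC n\<close> is \<open>A\<^sub>2\<^sub>n\<^sup>(\<^sup>2\<^sup>)\<close>, \<open>tCD n\<close> is \<open>B\<^sub>n\<^sup>(\<^sup>1\<^sup>)\<close>, \<open>tDD n\<close> is \<open>A\<^sub>2\<^sub>n\<^sub>-\<^sub>1\<^sup>(\<^sup>2\<^sup>)\<close>.
\<close>

datatype ext_dynkin =
    tA nat | tD nat | tE6 | tE7 | tE8
  | tG21 | tG22 | tF41 | tF42 | tA11 | tA12
  | tB nat | tC nat | tBC nat | tCD nat | tDD nat

fun ext_dynkin_range :: "ext_dynkin \<Rightarrow> bool" where
  "ext_dynkin_range (tA n) \<longleftrightarrow> n \<ge> 2"
| "ext_dynkin_range (tD n) \<longleftrightarrow> n \<ge> 4"
| "ext_dynkin_range (tB n) \<longleftrightarrow> n \<ge> 2"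
| "ext_dynkin_range (tC n) \<longleftrightarrow> n \<ge> 2"
| "ext_dynkin_range (tBC n) \<longleftrightarrow> n \<ge> 2"
| "ext_dynkin_range (tCD n) \<longleftrightarrow> n \<ge> 3"
| "ext_dynkin_range (tDD n) \<longleftrightarrow> n \<ge> 3"
| "ext_dynkin_range _ \<longleftrightarrow> True"

fun num_vertices :: "ext_dynkin \<Rightarrow> nat" where
  "num_vertices (tA n) = n + 1"
| "num_vertices (tD n) = n + 1"
| "num_vertices tE6 = 7"
| "num_vertices tE7 = 8"
| "num_vertices tE8 = 9"
| "num_vertices tG21 = 3"
| "num_vertices tG22 = 3"
| "num_vertices tF41 = 5"
| "num_vertices tF42 = 5"
| "num_vertices tA11 = 2"
| "num_vertices tA12 = 2"
| "num_vertices (tB n) = n + 1"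
| "num_vertices (tC n) = n + 1"
| "num_vertices (tBC n) = n + 1"
| "num_vertices (tCD n) = n + 1"
| "num_vertices (tDD n) = n + 1"

definition chain :: "nat \<Rightarrow> nat \<Rightarrow> valued_edge list" where
  "chain a b = map (\<lambda>i. (i, i + 1, 1, 1)) [a..<b]"

text \<open>
  The numbering of the vertices differs from Kac's for \<open>tD\<close>, \<open>tCD\<close>, \<open>tDD\<close>: here the longest chain
  comes first, and the remaining ends of the forks have the largest numbers. Thus every vertex
  of a diagram other than \<open>tA n\<close>, except \<open>0\<close>, has exactly one neighbour with a smaller number.
\<close>

fun edges :: "ext_dynkin \<Rightarrow> valued_edge list" where
  "edges (tA n) = chain 0 n @ [(0, n, 1, 1)]"
| "edges (tD n) = chain 0 (n - 2) @ [(1, n - 1, 1, 1), (n - 3, n, 1, 1)]"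
| "edges tE6 = chain 0 4 @ [(2, 5, 1, 1), (5, 6, 1, 1)]"
| "edges tE7 = chain 0 6 @ [(3, 7, 1, 1)]"
| "edges tE8 = chain 0 7 @ [(2, 8, 1, 1)]"
| "edges tG21 = [(0, 1, 1, 1), (1, 2, 3, 1)]"
| "edges tG22 = [(0, 1, 1, 1), (1, 2, 1, 3)]"
| "edges tF41 = [(0, 1, 1, 1), (1, 2, 1, 1), (2, 3, 2, 1), (3, 4, 1, 1)]"
| "edges tF42 = [(0, 1, 1, 1), (1, 2, 1, 1), (2, 3, 1, 2), (3, 4, 1, 1)]"
| "edges tA11 = [(0, 1, 4, 1)]"
| "edges tA12 = [(0, 1, 2, 2)]"
| "edges (tB n) = (0, 1, 2, 1) # chain 1 (n - 1) @ [(n - 1, n, 1, 2)]"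
| "edges (tC n) = (0, 1, 1, 2) # chain 1 (n - 1) @ [(n - 1, n, 2, 1)]"
| "edges (tBC n) = (0, 1, 2, 1) # chain 1 (n - 1) @ [(n - 1, n, 2, 1)]"
| "edges (tCD n) = chain 0 (n - 2) @ [(n - 2, n - 1, 1, 2), (1, n, 1, 1)]"
| "edges (tDD n) = chain 0 (n - 2) @ [(n - 2, n - 1, 2, 1), (1, n, 1, 1)]"

definition cartan_matrix :: "ext_dynkin \<Rightarrow> int mat" where
  "cartan_matrix X = cartan_of_edges (num_vertices X) (edges X)"

text \<open>\<open>K\<close> is the Cartan matrix of a diagram of type \<open>X\<close>, with arbitrarily numbered vertices.\<close>

definition has_diagram :: "int mat \<Rightarrow> ext_dynkin \<Rightarrow> bool" where
  "has_diagram K X \<longleftrightarrow> ext_dynkin_range X \<and>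
     K \<in> carrier_mat (num_vertices X) (num_vertices X) \<and>
     (\<exists>p. p permutes {..<num_vertices X} \<and>
       (\<forall>i < num_vertices X. \<forall>j < num_vertices X. K $$ (i, j) = cartan_matrix X $$ (p i, p j)))"


section \<open>Trees\<close>

definition adjacent :: "int mat \<Rightarrow> nat \<Rightarrow> nat \<Rightarrow> bool" where
  "adjacent K i j \<longleftrightarrow> i < dim_row K \<and> j < dim_row K \<and> i \<noteq> j \<and> K $$ (i, j) \<noteq> 0"

definition graph_cycle :: "int mat \<Rightarrow> nat list \<Rightarrow> bool" where
  "graph_cycle K vs \<longleftrightarrow> length vs \<ge> 3 \<and> distinct vs \<and> successively (adjacent K) vs \<and>
     adjacent K (last vs) (hd vs)"

definition is_tree :: "int mat \<Rightarrow> bool" where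
  "is_tree K \<longleftrightarrow> dim_row K > 0 \<and> (\<forall>i < dim_row K. \<forall>j < dim_row K. (adjacent K)\<^sup>*\<^sup>* i j) \<and>
     (\<nexists>vs. graph_cycle K vs)"


section \<open>The Coxeter transformation\<close>

text \<open>The matrix of the simple reflection \<open>z \<mapsto> z - (K z)\<^sub>v \<alpha>\<^sub>v\<close> in the basis of simple roots.\<close>

definition reflection :: "int mat \<Rightarrow> nat \<Rightarrow> int mat" where
  "reflection K v = mat (dim_row K) (dim_row K)
     (\<lambda>(i, j). (if i = j then 1 else 0) - (if i = v then K $$ (v, j) else 0))"

lemma reflection_mult_vec:
  assumes "K \<in> carrier_mat n n" "z \<in> carrier_vec n" "v < n"
  shows "reflection K v *\<^sub>v z = z - ((K *\<^sub>v z) $ v) \<cdot>\<^sub>v unit_vec n v"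
proof (rule eq_vecI)
  fix i assume "i < dim_vec (z - ((K *\<^sub>v z) $ v) \<cdot>\<^sub>v unit_vec n v)"
  then have i: "i < n" by simp
  have "(reflection K v *\<^sub>v z) $ i =
     (\<Sum>j = 0..<n. ((if i = j then 1 else 0) - (if i = v then K $$ (v, j) else 0)) * z $ j)"
    using assms i by (simp add: reflection_def scalar_prod_def)
  also have "\<dots> = (\<Sum>j = 0..<n. if i = j then z $ j else 0) -
      (if i = v then (\<Sum>j = 0..<n. K $$ (v, j) * z $ j) else 0)"
    by (auto simp: left_diff_distrib sum_subtractf if_distrib[of "\<lambda>x. x * _"] cong: if_cong)
  also have "\<dots> = (z - ((K *\<^sub>v z) $ v) \<cdot>\<^sub>v unit_vec n v) $ i"
    using assms i by (simp add: scalar_prod_def)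
  finally show "(reflection K v *\<^sub>v z) $ i = (z - ((K *\<^sub>v z) $ v) \<cdot>\<^sub>v unit_vec n v) $ i" .
qed (use assms in \<open>simp add: reflection_def\<close>)

definition vertex_order :: "int mat \<Rightarrow> nat list \<Rightarrow> bool" where
  "vertex_order K vs \<longleftrightarrow> distinct vs \<and> set vs = {..<dim_row K}"

definition coxeter_transformation :: "int mat \<Rightarrow> nat list \<Rightarrow> int mat" where
  "coxeter_transformation K vs = foldr (\<lambda>v C. reflection K v * C) vs (1\<^sub>m (dim_row K))"

text \<open>Complex eigenvalues, with their algebraic multiplicities.\<close>

definition eigenvalue_mset :: "int mat \<Rightarrow> complex multiset" where
  "eigenvalue_mset C = proots (char_poly (map_mat of_int C))"


section \<open>The extended Dynkin diagrams that are trees\<close>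

lemma adjacent_cartan_of_edges:
  assumes "\<And>u v a b. (u, v, a, b) \<in> set E \<Longrightarrow> a > 0 \<and> b > 0"
  shows "adjacent (cartan_of_edges N E) i j \<longleftrightarrow>
    i < N \<and> j < N \<and> i \<noteq> j \<and> (\<exists>a b. (i, j, a, b) \<in> set E \<or> (j, i, a, b) \<in> set E)"
proof -
  let ?f = "\<lambda>(u, v, a, b). if (i, j) = (u, v) then a else if (i, j) = (v, u) then b else (0 :: int)"
  have f: "?f e \<ge> 0 \<and> (?f e \<noteq> 0 \<longleftrightarrow> (\<exists>a b. e = (i, j, a, b) \<or> e = (j, i, a, b)))"
    if "e \<in> set E" for e
  proof -
    obtain u v a b where e: "e = (u, v, a, b)" by (cases e)
    then have ab: "a > 0" "b > 0" using assms that by auto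
    have "?f (u, v, a, b) \<ge> 0" using ab by simp
    moreover have "?f (u, v, a, b) \<noteq> 0 \<longleftrightarrow> (i = u \<and> j = v \<or> i = v \<and> j = u)" using ab by simp
    moreover have "(\<exists>a' b'. (u, v, a, b) = (i, j, a', b') \<or> (u, v, a, b) = (j, i, a', b')) \<longleftrightarrow>
        (i = u \<and> j = v \<or> i = v \<and> j = u)" by blast
    ultimately show ?thesis unfolding e by (simp only:)
  qed
  have "sum_list (map ?f E) \<noteq> 0 \<longleftrightarrow> \<not> (\<forall>x \<in> set (map ?f E). x = 0)"
    by (subst sum_list_nonneg_eq_0_iff) (use f in \<open>simp_all only: set_map, blast\<close>)
  also have "\<dots> \<longleftrightarrow> (\<exists>e \<in> set E. ?f e \<noteq> 0)"
    by (simp only: set_map ball_simps bex_simps not_all)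
  also have "\<dots> \<longleftrightarrow> (\<exists>e \<in> set E. \<exists>a b. e = (i, j, a, b) \<or> e = (j, i, a, b))"
    using f by (intro bex_cong refl) blast
  also have "\<dots> \<longleftrightarrow> (\<exists>a b. (i, j, a, b) \<in> set E \<or> (j, i, a, b) \<in> set E)"
    by blast
  finally show ?thesis
    by (auto simp: adjacent_def cartan_of_edges_def)
qed

lemma is_treeI:
  assumes pos: "dim_row K > 0"
    and sym: "\<And>i j. adjacent K i j \<Longrightarrow> adjacent K j i"
    and parent: "\<And>v. 0 < v \<Longrightarrow> v < dim_row K \<Longrightarrow> \<exists>!u. u < v \<and> adjacent K u v"
  shows "is_tree K"
proof -
  have symp: "symp (adjacent K)" using sym by (auto simp: symp_def)
  have root: "(adjacent K)\<^sup>*\<^sup>* v 0" if "v < dim_row K" for v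
    using that
  proof (induction v rule: less_induct)
    case (less v)
    show ?case
    proof (cases "v = 0")
      case False
      then obtain u where u: "u < v" "adjacent K u v" using parent less.prems by blast
      then have "(adjacent K)\<^sup>*\<^sup>* u 0" using less by auto
      then show ?thesis using sym[OF u(2)] by (rule converse_rtranclp_into_rtranclp[rotated])
    qed simp
  qed
  have conn: "(adjacent K)\<^sup>*\<^sup>* i j" if "i < dim_row K" "j < dim_row K" for i j
    using root[OF that(1)] root[OF that(2)] symp
    by (meson rtranclp_trans symp_rtranclp sympD)
  have False if cyc: "graph_cycle K vs" for vs
  proof -
    define n where "n = length vs"
    have n: "n \<ge> 3" and dist: "distinct vs" using cyc by (auto simp: graph_cycle_def n_def)
    have step: "adjacent K (vs ! i) (vs ! ((i + 1) mod n))" if "i < n" for i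
    proof (cases "i + 1 = n")
      case True
      have "vs \<noteq> []" using n by (auto simp: n_def)
      then have "last vs = vs ! (n - 1)" "hd vs = vs ! 0"
        by (simp_all add: last_conv_nth hd_conv_nth n_def)
      moreover have "i = n - 1" "(i + 1) mod n = 0" using True by auto
      ultimately show ?thesis using cyc by (simp add: graph_cycle_def)
    next
      case False
      then show ?thesis using cyc that
        by (auto simp: graph_cycle_def n_def successively_conv_nth)
    qed
    have "finite (set vs)" "set vs \<noteq> {}" using n by (auto simp: n_def)
    then have "Max (set vs) \<in> set vs" by simp
    then obtain i where i: "i < n" "vs ! i = Max (set vs)" by (auto simp: in_set_conv_nth n_def)
    let ?s = "(i + 1) mod n" and ?p = "(i + n - 1) mod n"
    have sp: "?s < n" "?p < n" using n by auto
    have ps: "?s \<noteq> ?p" "?s \<noteq> i" "?p \<noteq> i" "(?p + 1) mod n = i"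
    proof -
      have "?s = (if i + 1 = n then 0 else i + 1)" using i by auto
      moreover have "?p = (if i = 0 then n - 1 else i - 1)"
        using i n by (auto simp: mod_if)
      ultimately show "?s \<noteq> ?p" "?s \<noteq> i" "?p \<noteq> i" "(?p + 1) mod n = i"
        using i n by (auto split: if_splits)
    qed
    have small: "vs ! j < vs ! i" if "j < n" "j \<noteq> i" for j
    proof -
      have "vs ! j \<le> vs ! i" using that i by (simp add: n_def)
      moreover have "vs ! j \<noteq> vs ! i"
        using that i(1) dist nth_eq_iff_index_eq[of vs j i] by (simp add: n_def)
      ultimately show ?thesis by simp
    qed
    have "adjacent K (vs ! ?s) (vs ! i)" using step[OF i(1)] sym by blast
    moreover have "adjacent K (vs ! ?p) (vs ! i)" using step[OF sp(2)] ps(4) by simp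
    moreover have "vs ! i < dim_row K" using step[OF i(1)] by (simp add: adjacent_def)
    moreover have "vs ! ?s < vs ! i" "vs ! ?p < vs ! i" using small sp ps by auto
    ultimately have "vs ! ?s = vs ! ?p"
      using parent[of "vs ! i"] by (metis gr_zeroI not_less_zero)
    then show False using ps(1) sp dist nth_eq_iff_index_eq[of vs ?s ?p] by (simp add: n_def)
  qed
  then show ?thesis using pos conn by (auto simp: is_tree_def)
qed

lemma set_chain: "(u, v, a, b) \<in> set (chain x y) \<longleftrightarrow> x \<le> u \<and> u < y \<and> v = u + 1 \<and> a = 1 \<and> b = 1"
  by (auto simp: chain_def)

lemma adjacent_cartan_matrix:
  "adjacent (cartan_matrix X) i j \<longleftrightarrow> i < num_vertices X \<and> j < num_vertices X \<and> i \<noteq> j \<and>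
     (\<exists>a b. (i, j, a, b) \<in> set (edges X) \<or> (j, i, a, b) \<in> set (edges X))"
  unfolding cartan_matrix_def
  by (rule adjacent_cartan_of_edges) (cases X; auto simp: set_chain)

lemma is_tree_cartan_matrix:
  assumes "ext_dynkin_range X" "\<And>n. X \<noteq> tA n"
  shows "is_tree (cartan_matrix X)"
proof (rule is_treeI)
  have dim: "dim_row (cartan_matrix X) = num_vertices X"
    by (simp add: cartan_matrix_def cartan_of_edges_def)
  show "dim_row (cartan_matrix X) > 0" unfolding dim by (cases X) auto
  show "adjacent (cartan_matrix X) j i" if "adjacent (cartan_matrix X) i j" for i j
    using that by (auto simp: adjacent_cartan_matrix)
  fix v assume v: "0 < v" "v < dim_row (cartan_matrix X)"
  have less: "u < w" if "(u, w, a, b) \<in> set (edges X)" for u w a b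
    using that assms by (cases X) (auto simp: set_chain)
  have "\<exists>!u. \<exists>a b. (u, v, a, b) \<in> set (edges X)"
  proof (cases X)
    case (tD n)
    consider "v \<le> n - 2" | "v = n - 1" | "v = n" using v tD unfolding dim by force
    then show ?thesis
    proof cases
      case 1
      moreover have "n \<ge> 4" using tD assms by simp
      ultimately have "v - 1 < n - 2" "v = v - 1 + 1" "v \<noteq> n - 1" "v \<noteq> n" using v by auto
      then show ?thesis using tD by (intro ex1I[of _ "v - 1"]) (auto simp: set_chain)
    next
      case 2
      then show ?thesis using v tD assms by (intro ex1I[of _ 1]) (auto simp: set_chain)
    next
      case 3
      then show ?thesis using v tD assms by (intro ex1I[of _ "n - 3"]) (auto simp: set_chain)
    qed
  next
    case (tCD n)
    show ?thesis
    proof (cases "v = n")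
      case True
      then show ?thesis using v tCD assms by (intro ex1I[of _ 1]) (auto simp: set_chain)
    next
      case False
      then have "v - 1 < n - 2 \<or> v = n - 1" "v = v - 1 + 1" "n \<ge> 3" "v \<noteq> n"
        using v tCD assms unfolding dim by auto
      then show ?thesis using tCD
        by (intro ex1I[of _ "v - 1"]) (auto simp: set_chain numeral_2_eq_2)
    qed
  next
    case (tDD n)
    show ?thesis
    proof (cases "v = n")
      case True
      then show ?thesis using v tDD assms by (intro ex1I[of _ 1]) (auto simp: set_chain)
    next
      case False
      then have "v - 1 < n - 2 \<or> v = n - 1" "v = v - 1 + 1" "n \<ge> 3" "v \<noteq> n"
        using v tDD assms unfolding dim by auto
      then show ?thesis using tDD
        by (intro ex1I[of _ "v - 1"]) (auto simp: set_chain numeral_2_eq_2)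
    qed
  next
    case tE6
    then have "v \<in> {1, 2, 3, 4, 5, 6}" using v unfolding dim by auto
    then show ?thesis using tE6
      by (intro ex1I[of _ "if v = 5 then 2 else v - 1"]) (auto simp: set_chain)
  next
    case tE7
    then have "v \<in> {1, 2, 3, 4, 5, 6, 7}" using v unfolding dim by auto
    then show ?thesis using tE7
      by (intro ex1I[of _ "if v = 7 then 3 else v - 1"]) (auto simp: set_chain)
  next
    case tE8
    then have "v \<in> {1, 2, 3, 4, 5, 6, 7, 8}" using v unfolding dim by auto
    then show ?thesis using tE8
      by (intro ex1I[of _ "if v = 8 then 2 else v - 1"]) (auto simp: set_chain)
  next
    case (tB n)
    have "v = 1 \<or> 1 \<le> v - 1 \<and> v - 1 < n - 1 \<and> v \<noteq> n \<or> v = n" "v = v - 1 + 1" "n \<ge> 2"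
      using v tB assms unfolding dim by auto
    then show ?thesis using tB by (intro ex1I[of _ "v - 1"]) (auto simp: set_chain)
  next
    case (tC n)
    have "v = 1 \<or> 1 \<le> v - 1 \<and> v - 1 < n - 1 \<and> v \<noteq> n \<or> v = n" "v = v - 1 + 1" "n \<ge> 2"
      using v tC assms unfolding dim by auto
    then show ?thesis using tC by (intro ex1I[of _ "v - 1"]) (auto simp: set_chain)
  next
    case (tBC n)
    have "v = 1 \<or> 1 \<le> v - 1 \<and> v - 1 < n - 1 \<and> v \<noteq> n \<or> v = n" "v = v - 1 + 1" "n \<ge> 2"
      using v tBC assms unfolding dim by auto
    then show ?thesis using tBC by (intro ex1I[of _ "v - 1"]) (auto simp: set_chain)
  next
    case (tA n)
    then show ?thesis using assms by blast
  next
    case tG21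
    then have "v \<in> {1, 2}" using v unfolding dim by auto
    then show ?thesis using tG21 by (intro ex1I[of _ "v - 1"]) auto
  next
    case tG22
    then have "v \<in> {1, 2}" using v unfolding dim by auto
    then show ?thesis using tG22 by (intro ex1I[of _ "v - 1"]) auto
  next
    case tF41
    then have "v \<in> {1, 2, 3, 4}" using v unfolding dim by auto
    then show ?thesis using tF41 by (intro ex1I[of _ "v - 1"]) auto
  next
    case tF42
    then have "v \<in> {1, 2, 3, 4}" using v unfolding dim by auto
    then show ?thesis using tF42 by (intro ex1I[of _ "v - 1"]) auto
  next
    case tA11
    then have "v \<in> {1}" using v unfolding dim by auto
    then show ?thesis using tA11 by (intro ex1I[of _ "v - 1"]) auto
  next
    case tA12
    then have "v \<in> {1}" using v unfolding dim by auto
    then show ?thesis using tA12 by (intro ex1I[of _ "v - 1"]) auto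
  qed
  then obtain u where u: "\<exists>a b. (u, v, a, b) \<in> set (edges X)"
    and uniq: "\<And>u' a b. (u', v, a, b) \<in> set (edges X) \<Longrightarrow> u' = u" by blast
  show "\<exists>!u. u < v \<and> adjacent (cartan_matrix X) u v"
  proof (rule ex1I[of _ u])
    show "u < v \<and> adjacent (cartan_matrix X) u v"
      using u less v by (metis adjacent_cartan_matrix dim less_trans nat_neq_iff)
    show "u' = u" if "u' < v \<and> adjacent (cartan_matrix X) u' v" for u'
      using that uniq less by (meson adjacent_cartan_matrix less_asym)
  qed
qed

lemma not_is_tree_tA:
  assumes "n \<ge> 2"
  shows "\<not> is_tree (cartan_matrix (tA n))"
proof -
  have "graph_cycle (cartan_matrix (tA n)) [0..<n + 1]"
    using assms by (auto simp: graph_cycle_def adjacent_cartan_matrix set_chain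
        successively_conv_nth hd_upt simp del: upt_Suc)
  then show ?thesis by (auto simp: is_tree_def)
qed

end

theory Submission
  imports Defs
begin

text \<open>
  The Coxeter polynomial of every extended Dynkin tree is
  \<open>(x - 1)\<^sup>2 \<Prod>\<^sub>p (1 + x + \<dots> + x\<^sup>p\<^sup>-\<^sup>1)\<close>, where \<open>p\<close> runs through a short list of numbers \<open>arms X\<close>
  (\<open>char_poly_coxeter_transformation\<close>). A factor \<open>1 + x + \<dots> + x\<^sup>p\<^sup>-\<^sup>1\<close> contributes the \<open>p\<close>-th roots of
  unity other than \<open>1\<close>, and all eigenvalues can be read off.

  The order of the reflections splits the Cartan matrix as \<open>K = L + U\<close>, with both diagonals equal to \<open>1\<close>:
  \<open>L\<close> takes the entries \<open>K\<^sub>i\<^sub>j\<close> for which \<open>j\<close> is reflected before \<open>i\<close>, \<open>U\<close> the others. Following one vector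
  through the product \<open>C\<close> of the reflections shows \<open>L C = - U\<close>. As \<open>det L = 1\<close>, the
  characteristic polynomial at \<open>t\<close> is \<open>det (t L + U)\<close>. This matrix has diagonal \<open>t + 1\<close>, and its
  two entries at an edge with values \<open>a, b\<close> have the product \<open>t a b\<close>.

  On a tree such a determinant is computed by eliminating the vertices from the leaves to the root.
  A vertex has only one neighbour left when its turn comes, so the elimination creates no new entries
  (\<open>det_eq_prod_pivots\<close>). The determinant is the product of the pivots
  \<open>\<delta>\<^sub>v = t + 1 - \<Sum>\<^sub>w t a b / \<delta>\<^sub>w\<close>, the sum over the children \<open>w\<close> of \<open>v\<close>. Only the products \<open>t a b\<close>
  enter, so neither the order of the reflections nor the directions of the arrows matter
  (\<open>det_oriented_mat\<close>).

  The pivots are quotients of Coxeter polynomials of finite diagrams, which do not vanish for real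
  \<open>t > 1\<close>. For each type the pivots are written down, the recursion is checked, and the product telescopes
  to the claimed value. Agreement at all \<open>t > 1\<close> is agreement of polynomials.
\<close>

section \<open>Determinants by elimination from the leaves\<close>

text \<open>
  Gaussian elimination from the last vertex to the first. The hypothesis \<open>no_fill\<close> says that a vertex
  \<open>k\<close> couples to at most one smaller vertex, so that clearing its row and column changes nothing but
  one diagonal entry. The elimination is packaged as one factorisation \<open>M = A B\<close> with \<open>A\<close> unipotent
  upper triangular and \<open>B\<close> lower triangular with the pivots \<open>\<delta>\<close> on its diagonal.
\<close>

lemma det_eq_prod_pivots:
  fixes M :: "'a :: field mat" and \<delta> :: "nat \<Rightarrow> 'a"
  assumes M: "M \<in> carrier_mat n n"
    and no_fill: "\<And>i j k. i < k \<Longrightarrow> j < k \<Longrightarrow> k < n \<Longrightarrow> i \<noteq> j \<Longrightarrow> M $$ (i, k) * M $$ (k, j) = 0"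
    and diag: "\<And>i. i < n \<Longrightarrow>
      M $$ (i, i) = \<delta> i + (\<Sum>k \<in> {i<..<n}. M $$ (i, k) * M $$ (k, i) / \<delta> k)"
    and nz: "\<And>k. 0 < k \<Longrightarrow> k < n \<Longrightarrow> \<delta> k \<noteq> 0"
  shows "det M = (\<Prod>i<n. \<delta> i)"
proof -
  define A where "A = mat n n (\<lambda>(i, k). if i = k then 1 else if i < k then M $$ (i, k) / \<delta> k else 0)"
  define B where "B = mat n n (\<lambda>(k, j). if k = j then \<delta> k else if j < k then M $$ (k, j) else 0)"
  have A: "A \<in> carrier_mat n n" and B: "B \<in> carrier_mat n n" by (simp_all add: A_def B_def)
  \<comment> \<open>A term with \<open>k\<close> above \<open>i\<close> and \<open>j\<close> is \<open>M\<^sub>i\<^sub>k M\<^sub>k\<^sub>j / \<delta>\<^sub>k\<close>. It vanishes for \<open>i \<noteq> j\<close>;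
    for \<open>i = j\<close> these terms form the sum in \<open>diag\<close>.\<close>
  have "A * B = M"
  proof (rule eq_matI)
    fix i j assume "i < dim_row M" "j < dim_col M"
    then have ij: "i < n" "j < n" using M by auto
    have "(A * B) $$ (i, j) = (\<Sum>k<n. A $$ (i, k) * B $$ (k, j))"
      using A B ij by (auto simp: scalar_prod_def lessThan_atLeast0 intro!: sum.cong)
    also have "\<dots> = A $$ (i, i) * B $$ (i, j) + (\<Sum>k \<in> {..<n} - {i}. A $$ (i, k) * B $$ (k, j))"
      using ij by (subst sum.remove[of _ i]) auto
    also have "(\<Sum>k \<in> {..<n} - {i}. A $$ (i, k) * B $$ (k, j)) =
        (\<Sum>k \<in> {i<..<n}. A $$ (i, k) * B $$ (k, j))"
      by (rule sum.mono_neutral_right) (use ij in \<open>auto simp: A_def\<close>)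
    also have "A $$ (i, i) * B $$ (i, j) + (\<Sum>k \<in> {i<..<n}. A $$ (i, k) * B $$ (k, j)) = M $$ (i, j)"
    proof (cases "i < j")
      case True
      have "(\<Sum>k \<in> {i<..<n}. A $$ (i, k) * B $$ (k, j)) = (\<Sum>k \<in> {j}. A $$ (i, k) * B $$ (k, j))"
      proof (rule sum.mono_neutral_right)
        show "\<forall>k \<in> {i<..<n} - {j}. A $$ (i, k) * B $$ (k, j) = 0"
        proof
          fix k assume "k \<in> {i<..<n} - {j}"
          then show "A $$ (i, k) * B $$ (k, j) = 0"
            using no_fill[of i k j] ij True by (cases "j < k") (auto simp: A_def B_def)
        qed
      qed (use ij True in auto)
      then show ?thesis using True ij nz[of j] by (auto simp: A_def B_def)
    next
      case False
      have *: "A $$ (i, k) * B $$ (k, j) = M $$ (i, k) * M $$ (k, j) / \<delta> k" if "k \<in> {i<..<n}" for k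
        using that ij False by (auto simp: A_def B_def)
      show ?thesis
      proof (cases "i = j")
        case True
        then show ?thesis using diag[of i] ij * by (simp add: A_def B_def)
      next
        case ne: False
        have "A $$ (i, k) * B $$ (k, j) = 0" if "k \<in> {i<..<n}" for k
          using *[OF that] no_fill[of i k j] that ne False by auto
        then have "(\<Sum>k \<in> {i<..<n}. A $$ (i, k) * B $$ (k, j)) = 0" by (rule sum.neutral[OF ballI])
        then show ?thesis using ij ne False by (simp add: A_def B_def)
      qed
    qed
    finally show "(A * B) $$ (i, j) = M $$ (i, j)" .
  qed (use A B M in auto)
  then have "det M = det A * det B" using det_mult[OF A B] by simp
  also have "det A = 1"
    using det_upper_triangular[OF _ A] by (auto simp: A_def upper_triangular_def prod_list_diag_prod)
  also have "det B = (\<Prod>i<n. \<delta> i)"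
    by (subst det_lower_triangular[OF _ B]) (auto simp: B_def prod_list_diag_prod lessThan_atLeast0)
  finally show ?thesis by simp
qed

lemma det_permute_rows_cols:
  fixes M :: "'a :: comm_ring_1 mat"
  assumes M: "M \<in> carrier_mat n n" and p: "p permutes {..<n}"
  shows "det (mat n n (\<lambda>(i, j). M $$ (p i, p j))) = det M"
proof -
  have p': "p permutes {0..<n}" using p by (simp add: lessThan_atLeast0)
  have lt: "p i < n" if "i < n" for i using permutes_in_image[OF p, of i] that by simp
  define R where "R = mat n n (\<lambda>(i, j). M $$ (p i, j))"
  have R: "R \<in> carrier_mat n n" by (simp add: R_def)
  have "mat n n (\<lambda>(i, j). M $$ (p i, p j)) = transpose_mat (mat n n (\<lambda>(i, j). transpose_mat R $$ (p i, j)))"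
    by (rule eq_matI) (auto simp: R_def lt)
  then have "det (mat n n (\<lambda>(i, j). M $$ (p i, p j))) = det (mat n n (\<lambda>(i, j). transpose_mat R $$ (p i, j)))"
    by (simp only: det_transpose[OF mat_carrier])
  also have "\<dots> = signof p * det (transpose_mat R)"
    by (rule det_permute_rows) (use R p' in auto)
  also have "\<dots> = signof p * (signof p * det M)"
    using det_permute_rows[OF M p'] det_transpose[OF R] by (simp add: R_def)
  also have "\<dots> = det M" by (cases p rule: sign_cases) auto
  finally show ?thesis .
qed

section \<open>Cartan matrices of rooted forests\<close>

text \<open>
  Every edge goes from a parent to a larger child, and no vertex is the child of two edges:
  the diagram is a forest whose vertices are numbered from the roots to the leaves.
\<close>

definition downward_edges :: "nat \<Rightarrow> valued_edge list \<Rightarrow> bool" where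
  "downward_edges N E \<longleftrightarrow> (\<forall>(u, v, a, b) \<in> set E. u < v \<and> v < N) \<and>
     distinct (map (\<lambda>(u, v, a, b). v) E)"

lemma sum_list_mult_distinct:
  fixes g h :: "'e \<Rightarrow> 'a :: semiring_0"
  assumes "distinct (map f E)"
  shows "(\<Sum>e\<leftarrow>E. if f e = k then g e else 0) * (\<Sum>e\<leftarrow>E. if f e = k then h e else 0) =
    (\<Sum>e\<leftarrow>E. if f e = k then g e * h e else 0)"
  using assms
proof (induction E)
  case (Cons e E)
  show ?case
  proof (cases "f e = k")
    case True
    then have *: "f e' \<noteq> k" if "e' \<in> set E" for e'
      using Cons.prems that by (metis distinct.simps(2) image_eqI list.set_map list.simps(9))
    have "(\<Sum>e\<leftarrow>E. if f e = k then r e else 0) = 0" for r :: "'e \<Rightarrow> 'a"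
      using * by (induction E) auto
    with True show ?thesis by simp
  next
    case False
    with Cons show ?thesis by simp
  qed
qed simp

text \<open>
  The edge to the parent of \<open>k\<close> is unique, so the product of two entries that couple \<open>k\<close> to smaller
  vertices is \<open>a b\<close> if both belong to this edge and \<open>0\<close> otherwise. For \<open>i \<noteq> j\<close> this is the absence of
  fill-in; for \<open>i = j\<close> it gives the correction of the pivot of the parent.
\<close>

lemma of_int_cartan_mult:
  assumes E: "downward_edges N E" and "i < k" "j < k" "k < N"
  shows "of_int (cartan_of_edges N E $$ (i, k)) * of_int (cartan_of_edges N E $$ (k, j)) =
    (\<Sum>(u, v, a, b)\<leftarrow>E. if v = k \<and> u = i \<and> u = j then of_int a * of_int b else 0 :: 'a :: comm_ring_1)"
proof -
  let ?v = "\<lambda>(u, v, a, b). v :: nat"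
  let ?g = "\<lambda>(u, v, a, b). if u = i then a else (0::int)" and ?h = "\<lambda>(u, v, a, b). if u = j then b else (0::int)"
  have "cartan_of_edges N E $$ (i, k) = - (\<Sum>e\<leftarrow>E. if ?v e = k then ?g e else 0)"
    using assms by (auto simp: cartan_of_edges_def downward_edges_def intro!: arg_cong[where f=sum_list] map_cong)
  moreover have "cartan_of_edges N E $$ (k, j) = - (\<Sum>e\<leftarrow>E. if ?v e = k then ?h e else 0)"
    using assms by (auto simp: cartan_of_edges_def downward_edges_def intro!: arg_cong[where f=sum_list] map_cong)
  ultimately have "cartan_of_edges N E $$ (i, k) * cartan_of_edges N E $$ (k, j) =
      (\<Sum>e\<leftarrow>E. if ?v e = k then ?g e * ?h e else 0)"
    using sum_list_mult_distinct[of ?v E k ?g ?h] E by (simp add: downward_edges_def)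
  also have "\<dots> = (\<Sum>(u, v, a, b)\<leftarrow>E. if v = k \<and> u = i \<and> u = j then a * b else 0)"
    by (auto intro!: arg_cong[where f=sum_list])
  finally have "of_int (cartan_of_edges N E $$ (i, k) * cartan_of_edges N E $$ (k, j)) =
      (of_int (\<Sum>(u, v, a, b)\<leftarrow>E. if v = k \<and> u = i \<and> u = j then a * b else 0) :: 'a)"
    by (rule arg_cong)
  also have "\<dots> = (\<Sum>(u, v, a, b)\<leftarrow>E. if v = k \<and> u = i \<and> u = j then of_int a * of_int b else 0)"
    by (induction E) auto
  finally show ?thesis by simp
qed

section \<open>The order of the reflections\<close>

text \<open>
  The last reflection of the list acts first. Hence \<open>later vs v\<close> is the set of vertices whose
  coordinates are already updated when \<open>v\<close> is reflected.
\<close>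

definition later :: "nat list \<Rightarrow> nat \<Rightarrow> nat set" where
  "later vs v = set (tl (dropWhile (\<lambda>x. x \<noteq> v) vs))"

lemma later_Cons: "later (x # xs) v = (if x = v then set xs else later xs v)"
  by (simp add: later_def)

lemma later_Nil [simp]: "later [] v = {}"
  by (simp add: later_def)

lemma later_subset: "later vs v \<subseteq> set vs"
  by (induction vs) (auto simp: later_Cons)

text \<open>
  Of the two entries at an edge exactly one lies in the lower part of the Cartan matrix, whatever the
  order. This is why the order does not enter the determinant of a tree.
\<close>

lemma later_asym:
  assumes "distinct vs" "v \<in> set vs" "w \<in> set vs" "v \<noteq> w"
  shows "w \<in> later vs v \<longleftrightarrow> v \<notin> later vs w"
  using assms
proof (induction vs)
  case (Cons x xs)
  then show ?case using later_subset[of xs v] later_subset[of xs w] by (auto simp: later_Cons)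
qed simp

lemma not_later_self: "distinct vs \<Longrightarrow> v \<notin> later vs v"
  by (induction vs) (auto simp: later_Cons)

text \<open>
  Split the Cartan matrix as \<open>K = L + U\<close>, where \<open>L\<close> and \<open>U\<close> both have diagonal \<open>1\<close>, and \<open>L\<close> takes the
  entries \<open>K\<^sub>i\<^sub>j\<close> with \<open>j \<in> later vs i\<close>. Then \<open>oriented_mat K vs (s + r) s r\<close> is \<open>s L + r U\<close>; it is
  used for \<open>L\<close> itself and for \<open>t L + U\<close>.
\<close>

definition oriented_mat :: "int mat \<Rightarrow> nat list \<Rightarrow> 'a \<Rightarrow> 'a \<Rightarrow> 'a \<Rightarrow> 'a :: comm_ring_1 mat" where
  "oriented_mat K vs d s r = mat (dim_row K) (dim_row K) (\<lambda>(i, j).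
     if i = j then d else (if j \<in> later vs i then s else r) * of_int (K $$ (i, j)))"

text \<open>
  The pivots of the elimination from the leaves: each edge from \<open>u\<close> to \<open>v\<close> subtracts \<open>c a b / \<delta>\<^sub>v\<close> from
  the pivot of \<open>u\<close>. For \<open>d = t + 1\<close> and \<open>c = t\<close>, \<open>\<delta>\<^sub>v\<close> is the Coxeter polynomial of the subtree below \<open>v\<close>
  divided by those of the subtrees below its children, evaluated at \<open>t\<close>.
\<close>

definition pivot_family :: "nat \<Rightarrow> valued_edge list \<Rightarrow> 'a :: field \<Rightarrow> 'a \<Rightarrow> (nat \<Rightarrow> 'a) \<Rightarrow> bool" where
  "pivot_family N E d c \<delta> \<longleftrightarrow>
     (\<forall>i<N. \<delta> i = d - (\<Sum>(u, v, a, b)\<leftarrow>E. if u = i then c * (of_int a * of_int b) / \<delta> v else 0)) \<and>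
     (\<forall>i<N. 0 < i \<longrightarrow> \<delta> i \<noteq> 0)"

text \<open>
  A pair of opposite entries enters the elimination through its product only, and that is \<open>s r a b\<close> for
  every order of the vertices. Hence neither \<open>vs\<close> nor the numbering \<open>p\<close> occurs in the result.
\<close>

lemma det_oriented_mat:
  fixes d s r :: "'a :: field"
  assumes E: "downward_edges N E" and Kc: "K \<in> carrier_mat N N" and p: "p permutes {..<N}"
    and K: "\<And>i j. i < N \<Longrightarrow> j < N \<Longrightarrow> K $$ (i, j) = cartan_of_edges N E $$ (p i, p j)"
    and vs: "vertex_order K vs" and \<delta>: "pivot_family N E d (s * r) \<delta>"
  shows "det (oriented_mat K vs d s r) = (\<Prod>i<N. \<delta> i)"
proof -
  let ?q = "inv_into UNIV p" and ?C = "cartan_of_edges N E"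
  define M where "M = mat N N (\<lambda>(i, j). if i = j then d else
    (if ?q j \<in> later vs (?q i) then s else r) * of_int (?C $$ (i, j)))"
  have M: "M \<in> carrier_mat N N" by (simp add: M_def)
  have lt: "p i < N" "?q i < N" if "i < N" for i
    using permutes_in_image[OF p, of i] permutes_in_image[OF permutes_inv[OF p], of i] that by auto
  \<comment> \<open>The matrix in the standard numbering, in which parents precede their children.\<close>
  have "oriented_mat K vs d s r = mat N N (\<lambda>(i, j). M $$ (p i, p j))"
    by (rule eq_matI)
      (use Kc permutes_inj[OF p] in \<open>auto simp: oriented_mat_def M_def lt K permutes_inverses[OF p] inj_eq\<close>)
  then have "det (oriented_mat K vs d s r) = det M"
    using det_permute_rows_cols[OF M p] by simp
  also have "det M = (\<Prod>i<N. \<delta> i)"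
  proof (rule det_eq_prod_pivots[OF M])
    fix i j k assume ijk: "i < k" "j < k" "k < N" "i \<noteq> j"
    have "(\<Sum>(u, v, a, b)\<leftarrow>E. if v = k \<and> u = i \<and> u = j then of_int a * of_int b else 0 :: 'a) = 0"
      using ijk by (induction E) auto
    then have "of_int (?C $$ (i, k)) * of_int (?C $$ (k, j)) = (0 :: 'a)"
      using of_int_cartan_mult[OF E ijk(1-3), where ?'a = 'a] by simp
    then show "M $$ (i, k) * M $$ (k, j) = 0" using ijk by (auto simp: M_def)
  next
    fix i assume i: "i < N"
    have "M $$ (i, k) * M $$ (k, i) / \<delta> k =
        (\<Sum>(u, v, a, b)\<leftarrow>E. if v = k \<and> u = i then s * r * (of_int a * of_int b) / \<delta> v else 0)"
      if k: "k \<in> {i<..<N}" for k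
    proof -
      have "?q i \<noteq> ?q k" using k permutes_inj[OF permutes_inv[OF p]] by (auto simp: inj_eq)
      then have "?q k \<in> later vs (?q i) \<longleftrightarrow> ?q i \<notin> later vs (?q k)"
        by (intro later_asym) (use vs Kc lt i k in \<open>auto simp: vertex_order_def\<close>)
      then have "M $$ (i, k) * M $$ (k, i) / \<delta> k =
          s * r / \<delta> k * (of_int (?C $$ (i, k)) * of_int (?C $$ (k, i)))"
        using i k by (auto simp: M_def)
      also have "\<dots> = s * r / \<delta> k *
          (\<Sum>(u, v, a, b)\<leftarrow>E. if v = k \<and> u = i then of_int a * of_int b else 0)"
        by (subst of_int_cartan_mult[OF E]) (use k in auto)
      also have "\<dots> = (\<Sum>(u, v, a, b)\<leftarrow>E.
          if v = k \<and> u = i then s * r * (of_int a * of_int b) / \<delta> v else 0)"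
        by (induction E) (auto simp: distrib_left)
      finally show ?thesis .
    qed
    then have "(\<Sum>k \<in> {i<..<N}. M $$ (i, k) * M $$ (k, i) / \<delta> k) = (\<Sum>k \<in> {i<..<N}.
        \<Sum>(u, v, a, b)\<leftarrow>E. if v = k \<and> u = i then s * r * (of_int a * of_int b) / \<delta> v else 0)"
      by simp
    also have "\<dots> = (\<Sum>(u, v, a, b)\<leftarrow>E. if u = i then s * r * (of_int a * of_int b) / \<delta> v else 0)"
    proof -
      have "\<forall>(u, v, a, b) \<in> set E. u < v \<and> v < N" using E by (simp add: downward_edges_def)
      then show ?thesis
      proof (induction E)
        case (Cons e E)
        obtain u v a b where e: "e = (u, v, a, b)" by (cases e)
        have "(\<Sum>k \<in> {i<..<N}. if v = k \<and> u = i then c else 0) = (if u = i then c else 0)" for c :: 'a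
          using Cons.prems e by (cases "u = i") auto
        with Cons show ?case by (simp add: e sum.distrib)
      qed simp
    qed
    finally show "M $$ (i, i) = \<delta> i + (\<Sum>k \<in> {i<..<N}. M $$ (i, k) * M $$ (k, i) / \<delta> k)"
      using \<delta> i by (simp add: M_def pivot_family_def)
  next
    show "\<delta> k \<noteq> 0" if "0 < k" "k < N" for k using \<delta> that unfolding pivot_family_def by blast
  qed
  finally show ?thesis .
qed

section \<open>Coxeter transformations and triangular splittings\<close>

lemma coxeter_transformation_carrier [simp]:
  "K \<in> carrier_mat n n \<Longrightarrow> coxeter_transformation K vs \<in> carrier_mat n n"
  by (induction vs) (auto simp: coxeter_transformation_def reflection_def)

text \<open>
  Reflecting \<open>v\<close> uses the new coordinates of the vertices in \<open>later vs v\<close> and the old coordinates of all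
  others. As no coordinate is touched twice, the new ones are rows of the final product.
\<close>

lemma coxeter_transformation_row:
  assumes K: "K \<in> carrier_mat n n" and "distinct vs" "set vs \<subseteq> {..<n}" "v < n" "j < n"
  defines "C \<equiv> coxeter_transformation K vs"
  shows "C $$ (v, j) = (if v = j then 1 else 0) - (if v \<in> set vs then
    (\<Sum>k<n. K $$ (v, k) * (if k \<in> later vs v then C $$ (k, j) else if k = j then 1 else 0)) else 0)"
  using assms(2-4) unfolding C_def
proof (induction vs arbitrary: v)
  case Nil
  then show ?case using K \<open>j < n\<close> by (simp add: coxeter_transformation_def)
next
  case (Cons w ws)
  let ?D = "coxeter_transformation K ws" and ?C = "coxeter_transformation K (w # ws)"
  have D: "?D \<in> carrier_mat n n" using K by simp
  have IH: "?D $$ (k, j) = (if k = j then 1 else 0) - (if k \<in> set ws then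
      (\<Sum>l<n. K $$ (k, l) * (if l \<in> later ws k then ?D $$ (l, j) else if l = j then 1 else 0)) else 0)"
    if "k < n" for k
    using Cons.IH[of k] Cons.prems that by simp
  have step: "?C $$ (k, j) = ?D $$ (k, j) - (if k = w then (\<Sum>l<n. K $$ (w, l) * ?D $$ (l, j)) else 0)"
    if "k < n" for k
  proof -
    have "?C $$ (k, j) = (\<Sum>l<n. ((if k = l then 1 else 0) - (if k = w then K $$ (w, l) else 0)) * ?D $$ (l, j))"
      using K D that \<open>j < n\<close>
      by (simp add: coxeter_transformation_def reflection_def scalar_prod_def lessThan_atLeast0)
    also have "\<dots> = (\<Sum>l<n. (if k = l then ?D $$ (l, j) else 0) - (if k = w then K $$ (w, l) * ?D $$ (l, j) else 0))"
      by (rule sum.cong) (auto simp: algebra_simps)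
    also have "\<dots> = (\<Sum>l<n. if k = l then ?D $$ (l, j) else 0) -
        (\<Sum>l<n. if k = w then K $$ (w, l) * ?D $$ (l, j) else 0)"
      by (rule sum_subtractf)
    also have "\<dots> = ?D $$ (k, j) - (if k = w then (\<Sum>l<n. K $$ (w, l) * ?D $$ (l, j)) else 0)"
      using that by (simp add: sum.delta)
    finally show ?thesis .
  qed
  have same: "?C $$ (k, j) = ?D $$ (k, j)" if "k \<in> set ws" for k
    using step[of k] that Cons.prems by auto
  show ?case
  proof (cases "v = w")
    case True
    have "?D $$ (w, j) = (if w = j then 1 else 0)" using IH[of w] Cons.prems by auto
    moreover have "(\<Sum>l<n. K $$ (w, l) * ?D $$ (l, j)) =
        (\<Sum>l<n. K $$ (w, l) * (if l \<in> set ws then ?C $$ (l, j) else if l = j then 1 else 0))"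
      by (rule sum.cong) (auto simp: same IH)
    ultimately show ?thesis using True step[of v] Cons.prems by (simp add: later_Cons)
  next
    case False
    have "(\<Sum>l<n. K $$ (v, l) * (if l \<in> later ws v then ?C $$ (l, j) else if l = j then 1 else 0)) =
        (\<Sum>l<n. K $$ (v, l) * (if l \<in> later ws v then ?D $$ (l, j) else if l = j then 1 else 0))"
      using later_subset[of ws v] by (intro sum.cong) (auto simp: same)
    then show ?thesis using False step[of v] IH[of v] Cons.prems by (simp add: later_Cons)
  qed
qed

text \<open>
  Collecting the new coordinates in the previous lemma on the left gives \<open>L C = - U\<close>, whence
  \<open>L (t - C) = t L + U\<close>.
\<close>

lemma lower_part_mult_char_matrix:
  fixes t :: "'a :: field"
  assumes K: "K \<in> carrier_mat n n" and diag: "\<And>i. i < n \<Longrightarrow> K $$ (i, i) = 2"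
    and vs: "vertex_order K vs"
  defines "C \<equiv> map_mat of_int (coxeter_transformation K vs)"
  shows "oriented_mat K vs 1 1 0 * (- char_matrix C t) = oriented_mat K vs (t + 1) t 1"
proof (rule eq_matI)
  fix i j assume "i < dim_row (oriented_mat K vs (t + 1) t 1)" "j < dim_col (oriented_mat K vs (t + 1) t 1)"
  then have ij: "i < n" "j < n" using K by (auto simp: oriented_mat_def)
  have dist: "distinct vs" and set: "set vs = {..<n}" using vs K by (auto simp: vertex_order_def)
  let ?D = "coxeter_transformation K vs"
  have C: "C \<in> carrier_mat n n" and D: "?D \<in> carrier_mat n n" using K by (simp_all add: C_def)
  have CI: "C $$ (k, j) = of_int (?D $$ (k, j))" if "k < n" for k
    unfolding C_def using D that ij by (subst index_map_mat) auto
  let ?L = "\<lambda>k. (if k = i then 1 else if k \<in> later vs i then of_int (K $$ (i, k)) else 0 :: 'a)"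
  let ?b = "\<lambda>k. of_int (K $$ (i, k)) * (if k \<in> later vs i then C $$ (k, j) else 0)"
  let ?a = "\<lambda>k. of_int (K $$ (i, k)) * (if k \<in> later vs i then C $$ (k, j) else if k = j then 1 else 0)"
  have ni: "i \<notin> later vs i" using not_later_self[OF dist] .
  have "(oriented_mat K vs 1 1 0 * (- char_matrix C t)) $$ (i, j) =
      (\<Sum>k<n. ?L k * ((if k = j then t else 0) - C $$ (k, j)))"
    using K C ij by (auto simp: oriented_mat_def char_matrix_def scalar_prod_def lessThan_atLeast0
        sum_negf[symmetric] algebra_simps intro!: sum.cong)
  also have "\<dots> = (\<Sum>k<n. (if k = j then t * ?L j else 0) - ?L k * C $$ (k, j))"
    by (rule sum.cong) (auto simp: algebra_simps)
  also have "\<dots> = t * ?L j - (\<Sum>k<n. ?L k * C $$ (k, j))"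
    using ij by (simp add: sum_subtractf)
  also have "(\<Sum>k<n. ?L k * C $$ (k, j)) = (\<Sum>k<n. (if k = i then C $$ (i, j) else 0) +
      of_int (K $$ (i, k)) * (if k \<in> later vs i then C $$ (k, j) else 0))"
    using ni by (intro sum.cong) auto
  also have "\<dots> = C $$ (i, j) + sum ?b {..<n}"
    using ij by (simp add: sum.distrib)
  also have "C $$ (i, j) = (if i = j then 1 else 0) - sum ?a {..<n}"
  proof -
    have "C $$ (i, j) = of_int ((if i = j then 1 else 0) -
      (\<Sum>k<n. K $$ (i, k) * (if k \<in> later vs i then ?D $$ (k, j) else if k = j then 1 else 0)))"
      using coxeter_transformation_row[OF K dist, of i j] set ij CI[OF ij(1)] by simp
    also have "\<dots> = (if i = j then 1 else 0) - sum ?a {..<n}"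
      by (auto simp: of_int_sum CI intro!: sum.cong)
    finally show ?thesis .
  qed
  also have "(if i = j then 1 else 0) - sum ?a {..<n} + sum ?b {..<n} =
      (if i = j then 1 else 0) - (sum ?a {..<n} - sum ?b {..<n})"
    by simp
  also have "sum ?a {..<n} - sum ?b {..<n} =
      (\<Sum>k<n. if k = j then (if j \<in> later vs i then 0 else of_int (K $$ (i, j))) else 0)"
    unfolding sum_subtractf[symmetric] by (rule sum.cong) auto
  also have "(if i = j then 1 else 0) - \<dots> =
      (if i = j then 1 else 0) - (if j \<in> later vs i then 0 else of_int (K $$ (i, j)))"
    using ij by simp
  also have "t * ?L j - \<dots> = oriented_mat K vs (t + 1) t 1 $$ (i, j)"
    using ij K ni diag[of i] by (auto simp: oriented_mat_def)
  finally show "(oriented_mat K vs 1 1 0 * (- char_matrix C t)) $$ (i, j) =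
      oriented_mat K vs (t + 1) t 1 $$ (i, j)" .
qed (use K carrier_matD[OF coxeter_transformation_carrier[OF K, of vs]] in
    \<open>auto simp: oriented_mat_def C_def char_matrix_def\<close>)

section \<open>Pivots of the infinite families\<close>

lemma sum_list_chain:
  "(\<Sum>(u, v, a, b)\<leftarrow>chain x y. f u v a b) = (\<Sum>i = x..<y. f i (i + 1) 1 1)"
  by (simp add: chain_def comp_def interv_sum_list_conv_sum_set_nat)

lemma prod_telescope_ratio:
  fixes H :: "nat \<Rightarrow> 'a :: field"
  assumes "a \<le> b" "\<And>i. H i \<noteq> 0"
  shows "(\<Prod>i = a..<b. H i / H (Suc i)) = H a / H b"
  using assms(1) by (induction b rule: dec_induct) (simp_all add: assms(2) prod.atLeastLessThan_Suc)

text \<open>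
  With \<open>x = t\<^sup>k\<close> these are the pivot equations at an inner vertex of a tail, at the root before a double edge,
  at a vertex that carries an additional leaf, and at the root above such a vertex.
\<close>

lemma pivot_identities:
  fixes t x :: real
  assumes "t > 1" "x > 0"
  shows "(t * (t * x) + 1) / (t * x + 1) = t + 1 - t * ((x + 1) / (t * x + 1))"
    "(t - 1) * (t * x - 1) / (t * x + 1) = t + 1 - 2 * t / ((t * x + 1) / (x + 1))"
    "(t * (t * (t * x)) + 1) / ((t * x + 1) * (t + 1)) = t + 1 - (t * ((x + 1) / (t * x + 1)) + t / (t + 1))"
    "(t + 1) * (t - 1) * (t * (t * x) - 1) / (t * (t * (t * x)) + 1) =
      t + 1 - t / ((t * (t * (t * x)) + 1) / ((t * x + 1) * (t + 1)))"
proof -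
  have "t * x > 0" "t * (t * (t * x)) > 0" using assms by simp_all
  then have nz: "x + 1 \<noteq> 0" "t * x + 1 \<noteq> 0" "t * (t * (t * x)) + 1 \<noteq> 0" "t + 1 \<noteq> 0"
    using assms by linarith+
  show "(t * (t * x) + 1) / (t * x + 1) = t + 1 - t * ((x + 1) / (t * x + 1))"
    using nz by (simp add: divide_simps) (simp add: algebra_simps)
  show "(t - 1) * (t * x - 1) / (t * x + 1) = t + 1 - 2 * t / ((t * x + 1) / (x + 1))"
    using nz by (simp add: divide_simps) (simp add: algebra_simps)
  show "(t * (t * (t * x)) + 1) / ((t * x + 1) * (t + 1)) = t + 1 - (t * ((x + 1) / (t * x + 1)) + t / (t + 1))"
    using nz by (simp add: divide_simps) (simp add: algebra_simps)
  show "(t + 1) * (t - 1) * (t * (t * x) - 1) / (t * (t * (t * x)) + 1) =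
      t + 1 - t / ((t * (t * (t * x)) + 1) / ((t * x + 1) * (t + 1)))"
    using nz by (simp add: divide_simps) (simp add: algebra_simps)
qed

text \<open>
  A tail that ends in a double edge or in a fork has pivots \<open>H i / H (i + 1)\<close>, since the Coxeter
  polynomial of a finite diagram of type \<open>B\<^sub>k\<close> or \<open>C\<^sub>k\<close> is \<open>x\<^sup>k + 1\<close> and that of \<open>D\<^sub>k\<close> is
  \<open>(x\<^sup>k\<^sup>-\<^sup>1 + 1) (x + 1)\<close>. Both kinds of end subtract \<open>2 t / (t + 1)\<close> at the last inner vertex, which is what the
  formula \<open>t H (i + 2) / H (i + 1)\<close> gives there because \<open>H (m + 1) = 2\<close>.
\<close>

lemma tail_ratio:
  fixes t :: real
  assumes "t > 1" "i < m"
  defines "H \<equiv> \<lambda>i. t ^ (m + 1 - i) + 1"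
  shows "H i / H (Suc i) = t + 1 - t * (H (Suc (Suc i)) / H (Suc i))"
    "Suc i = m \<Longrightarrow> 2 * t / (t + 1) = t * (H (Suc (Suc i)) / H (Suc i))"
proof -
  obtain k where k: "m = i + Suc k" using assms(2) less_imp_Suc_add by auto
  then show "H i / H (Suc i) = t + 1 - t * (H (Suc (Suc i)) / H (Suc i))"
    "Suc i = m \<Longrightarrow> 2 * t / (t + 1) = t * (H (Suc (Suc i)) / H (Suc i))"
    using pivot_identities(1)[of t "t ^ k"] assms(1) by (simp_all add: H_def Suc_diff_le)
qed

text \<open>
  The types \<open>tB\<close>, \<open>tC\<close> and \<open>tBC\<close> differ in the directions of the double edges only, and the pivots see
  nothing but the products \<open>a b = 2\<close>.
\<close>

lemma pivots_double_double:
  fixes t :: real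
  assumes t: "t > 1" and n: "n \<ge> 2" and ab: "a * b = 2" "a' * b' = 2"
  shows "\<exists>\<delta>. pivot_family (n + 1) ((0, 1, a, b) # chain 1 (n - 1) @ [(n - 1, n, a', b')]) (t + 1) t \<delta> \<and>
    (\<Prod>i<n + 1. \<delta> i) = (t - 1)\<^sup>2 * (\<Sum>i<n. t ^ i)"
proof -
  define H where "H = (\<lambda>i. t ^ (n + 1 - i) + 1)"
  define \<delta> where "\<delta> = (\<lambda>i. if i = 0 then (t - 1) * (t ^ n - 1) / H 1 else if i = n then t + 1 else H i / H (Suc i))"
  have H: "H i > 0" for i using t by (simp add: H_def add_pos_pos)
  have nz: "H i \<noteq> 0" for i using H[of i] by simp
  have ab': "of_int a * of_int b = (2 :: real)" "of_int a' * of_int b' = (2 :: real)"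
    using ab by (metis of_int_mult of_int_numeral)+
  have "\<delta> i = t + 1 - (\<Sum>(u, v, a, b)\<leftarrow>(0, 1, a, b) # chain 1 (n - 1) @ [(n - 1, n, a', b')].
      if u = i then t * (of_int a * of_int b) / \<delta> v else 0)"
    if "i < n + 1" for i
  proof -
    have *: "(\<Sum>(u, v, a, b)\<leftarrow>(0, 1, a, b) # chain 1 (n - 1) @ [(n - 1, n, a', b')].
      if u = i then t * (of_int a * of_int b) / \<delta> v else 0) =
      (if i = 0 then 2 * t / \<delta> 1 else if i = n - 1 then 2 * t / (t + 1) else if i = n then 0 else t / \<delta> (Suc i))"
      using n that by (auto simp: sum_list_chain ab' \<delta>_def)
    have "i = 0 \<or> 0 < i \<and> i < n \<or> i = n" using that by linarith
    then consider "i = 0" | "0 < i" "i < n" | "i = n" by blast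
    then show ?thesis
    proof cases
      case 1
      have "t ^ n = t * t ^ (n - 1)" using n by (simp add: power_eq_if)
      then show ?thesis unfolding * using 1 n t pivot_identities(2)[of t "t ^ (n - 1)"]
        by (simp add: \<delta>_def H_def)
    next
      case 2
      have "(if i = n - 1 then 2 * t / (t + 1) else t / \<delta> (Suc i)) = t * (H (Suc (Suc i)) / H (Suc i))"
      proof (cases "Suc i = n")
        case True
        then show ?thesis using tail_ratio(2)[OF t 2(2)] unfolding H_def by auto
      next
        case False
        then show ?thesis using 2 by (auto simp: \<delta>_def)
      qed
      moreover have "\<delta> i = t + 1 - t * (H (Suc (Suc i)) / H (Suc i))"
        using 2 tail_ratio(1)[OF t 2(2)] by (simp only: \<delta>_def H_def) simp
      ultimately have "\<delta> i = t + 1 - (if i = n - 1 then 2 * t / (t + 1) else t / \<delta> (Suc i))" by simp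
      moreover have "i \<noteq> 0" "i \<noteq> n" using 2 by simp_all
      ultimately show ?thesis unfolding * by simp
    next
      case 3
      then show ?thesis unfolding * using n by (simp add: \<delta>_def)
    qed
  qed
  moreover have "\<delta> i \<noteq> 0" if "0 < i" for i using that nz t by (simp add: \<delta>_def)
  ultimately have "pivot_family (n + 1) ((0, 1, a, b) # chain 1 (n - 1) @ [(n - 1, n, a', b')]) (t + 1) t \<delta>"
    unfolding pivot_family_def by blast
  moreover have "(\<Prod>i<n + 1. \<delta> i) = (t - 1)\<^sup>2 * (\<Sum>i<n. t ^ i)"
  proof -
    have "{..<n + 1} = insert 0 (insert n {1..<n})" using n by auto
    then have "(\<Prod>i<n + 1. \<delta> i) = \<delta> 0 * (\<delta> n * (\<Prod>i = 1..<n. \<delta> i))" using n by simp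
    also have "(\<Prod>i = 1..<n. \<delta> i) = (\<Prod>i = 1..<n. H i / H (Suc i))"
      by (rule prod.cong) (auto simp: \<delta>_def)
    also have "\<dots> = H 1 / H n" using n nz by (intro prod_telescope_ratio) auto
    also have "\<delta> 0 * (\<delta> n * (H 1 / H n)) = (t - 1) * (t ^ n - 1)"
      using n nz[of 1] nz[of n] by (simp add: \<delta>_def) (simp add: H_def)
    finally show ?thesis by (simp add: power_diff_1_eq power2_eq_square)
  qed
  ultimately show ?thesis by blast
qed

text \<open>
  The types \<open>tCD\<close> and \<open>tDD\<close>. Vertex \<open>1\<close> carries the additional leaf \<open>n\<close>; the subtree below it is of finite
  type \<open>B\<^sub>n\<close> or \<open>C\<^sub>n\<close>, which explains the numerator \<open>H 0\<close> of its pivot.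
\<close>

lemma pivots_fork_double:
  fixes t :: real
  assumes t: "t > 1" and n: "n \<ge> 3" and ab: "a * b = 2"
  shows "\<exists>\<delta>. pivot_family (n + 1) (chain 0 (n - 2) @ [(n - 2, n - 1, a, b), (1, n, 1, 1)]) (t + 1) t \<delta> \<and>
    (\<Prod>i<n + 1. \<delta> i) = (t - 1)\<^sup>2 * (\<Sum>i<n - 1. t ^ i) * (t + 1)"
proof -
  let ?E = "chain 0 (n - 2) @ [(n - 2, n - 1, a, b), (1, n, 1, 1)]"
  define H where "H = (\<lambda>i. t ^ (n - i) + 1)"
  define \<delta> where "\<delta> = (\<lambda>i. if i = 0 then (t + 1) * (t - 1) * (t ^ (n - 1) - 1) / H 0
    else if i = 1 then H 0 / (H 2 * (t + 1)) else if i < n - 1 then H i / H (Suc i) else t + 1)"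
  have H: "H i > 0" for i using t by (simp add: H_def add_pos_pos)
  have nz: "H i \<noteq> 0" for i using H[of i] by simp
  have ab': "of_int a * of_int b = (2 :: real)" using ab by (metis of_int_mult of_int_numeral)
  obtain k where k: "n = k + 3" using n by (metis add.commute le_Suc_ex)
  have xk: "t ^ k > 0" using t by simp
  have top1: "\<delta> 1 = t + 1 - (t * (H 3 / H 2) + t / (t + 1))"
    using pivot_identities(3)[OF t xk] by (simp add: \<delta>_def H_def k eval_nat_numeral)
  have top0: "\<delta> 0 = t + 1 - t / \<delta> 1"
    using pivot_identities(4)[OF t xk] by (simp add: \<delta>_def H_def k eval_nat_numeral)
  have tail: "H i / H (Suc i) = t + 1 - t * (H (Suc (Suc i)) / H (Suc i))"
    "(if i < n - 2 then t / \<delta> (Suc i) else if i = n - 2 then 2 * t / (t + 1) else 0) =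
      t * (H (Suc (Suc i)) / H (Suc i))"
    if "0 < i" "i < n - 1" for i
  proof -
    have H': "H = (\<lambda>i. t ^ (n - 1 + 1 - i) + 1)" using n by (simp add: H_def)
    show "H i / H (Suc i) = t + 1 - t * (H (Suc (Suc i)) / H (Suc i))"
      using tail_ratio(1)[OF t that(2)] unfolding H' .
    show "(if i < n - 2 then t / \<delta> (Suc i) else if i = n - 2 then 2 * t / (t + 1) else 0) =
      t * (H (Suc (Suc i)) / H (Suc i))"
    proof (cases "Suc i = n - 1")
      case True
      have "2 * t / (t + 1) = t * (H (Suc (Suc i)) / H (Suc i))"
        using tail_ratio(2)[OF t that(2) True] unfolding H' .
      moreover have "i = n - 2" using True by simp
      ultimately show ?thesis by simp
    next
      case False
      then have "i < n - 2" "Suc i < n - 1" using that by simp_all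
      then show ?thesis using that by (simp add: \<delta>_def)
    qed
  qed
  have "\<delta> i = t + 1 - (\<Sum>(u, v, a, b)\<leftarrow>?E. if u = i then t * (of_int a * of_int b) / \<delta> v else 0)"
    if "i < n + 1" for i
  proof -
    have *: "(\<Sum>(u, v, a, b)\<leftarrow>?E. if u = i then t * (of_int a * of_int b) / \<delta> v else 0) =
      (if i < n - 2 then t / \<delta> (Suc i) else if i = n - 2 then 2 * t / (t + 1) else 0) + (if i = 1 then t / (t + 1) else 0)"
      using n that by (auto simp: sum_list_chain ab' \<delta>_def)
    have "i = 0 \<or> i = 1 \<or> 1 < i \<and> i < n - 1 \<or> n - 1 \<le> i" by linarith
    then consider "i = 0" | "i = 1" | "1 < i" "i < n - 1" | "n - 1 \<le> i" by blast
    then show ?thesis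
    proof cases
      case 1
      then show ?thesis unfolding * using n top0 by simp
    next
      case 2
      have Suc: "Suc 1 = 2" "Suc 2 = 3" by simp_all
      have head: "(if 1 < n - 2 then t / \<delta> 2 else if 1 = n - 2 then 2 * t / (t + 1) else 0) =
          t * (H 3 / H 2)"
        by (rule tail(2)[of 1, unfolded Suc]) (use n in simp_all)
      show ?thesis unfolding * unfolding 2 Suc head top1 by simp
    next
      case 3
      then have "\<delta> i = t + 1 - t * (H (Suc (Suc i)) / H (Suc i))" using tail(1)[of i] by (simp add: \<delta>_def)
      then show ?thesis unfolding * using tail(2)[of i] 3 by simp
    next
      case 4
      then have "i \<noteq> 0" "i \<noteq> 1" "\<not> i < n - 1" "\<not> i < n - 2" "i \<noteq> n - 2" using n by simp_all
      then show ?thesis unfolding * by (simp add: \<delta>_def)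
    qed
  qed
  moreover have "\<delta> i \<noteq> 0" if "0 < i" for i using that nz t by (simp add: \<delta>_def)
  ultimately have "pivot_family (n + 1) ?E (t + 1) t \<delta>"
    unfolding pivot_family_def by blast
  moreover have "(\<Prod>i<n + 1. \<delta> i) = (t - 1)\<^sup>2 * (\<Sum>i<n - 1. t ^ i) * (t + 1)"
  proof -
    have "{..<n + 1} = insert 0 (insert 1 (insert (n - 1) (insert n {2..<n - 1})))" using n by auto
    moreover have ne: "n - 1 \<noteq> 0" "n - 1 \<noteq> 1" "n - 1 \<noteq> n"
      using n by simp_all
    ultimately have "(\<Prod>i<n + 1. \<delta> i) = \<delta> 0 * (\<delta> 1 * (\<delta> (n - 1) * (\<delta> n * (\<Prod>i = 2..<n - 1. \<delta> i))))"
      using n by simp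
    also have "(\<Prod>i = 2..<n - 1. \<delta> i) = (\<Prod>i = 2..<n - 1. H i / H (Suc i))"
      by (rule prod.cong) (auto simp: \<delta>_def)
    also have "\<dots> = H 2 / H (n - 1)" using n nz by (intro prod_telescope_ratio) auto
    also have "\<dots> = H 2 / (t + 1)" using n by (simp add: H_def)
    also have "\<delta> 0 * (\<delta> 1 * (\<delta> (n - 1) * (\<delta> n * \<dots>))) = (t + 1) * ((t - 1) * (t ^ (n - 1) - 1))"
      using n nz[of 0] nz[of 2] t ne by (simp add: \<delta>_def)
    finally show ?thesis by (simp add: power_diff_1_eq power2_eq_square)
  qed
  ultimately show ?thesis by blast
qed

text \<open>
  The type \<open>tD\<close>. Two leaves hang on vertex \<open>n - 3\<close> and act like the double edge of the preceding types,
  so the same pivots occur on a tail that is shorter by one vertex.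
\<close>

lemma pivots_fork_fork:
  fixes t :: real
  assumes t: "t > 1" and n: "n \<ge> 4"
  shows "\<exists>\<delta>. pivot_family (n + 1) (chain 0 (n - 2) @ [(1, n - 1, 1, 1), (n - 3, n, 1, 1)]) (t + 1) t \<delta> \<and>
    (\<Prod>i<n + 1. \<delta> i) = (t - 1)\<^sup>2 * (\<Sum>i<n - 2. t ^ i) * (t + 1)\<^sup>2"
proof -
  let ?E = "chain 0 (n - 2) @ [(1, n - 1, 1, 1), (n - 3, n, 1, 1)]"
  define H where "H = (\<lambda>i. t ^ (n - 1 - i) + 1)"
  define \<delta> where "\<delta> = (\<lambda>i. if i = 0 then (t + 1) * (t - 1) * (t ^ (n - 2) - 1) / H 0
    else if i = 1 then H 0 / (H 2 * (t + 1)) else if i < n - 2 then H i / H (Suc i) else t + 1)"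
  have H: "H i > 0" for i using t by (simp add: H_def add_pos_pos)
  have nz: "H i \<noteq> 0" for i using H[of i] by simp
  obtain k where k: "n = k + 4" using n by (metis add.commute le_Suc_ex)
  have xk: "t ^ k > 0" using t by simp
  have top1: "\<delta> 1 = t + 1 - (t * (H 3 / H 2) + t / (t + 1))"
    using pivot_identities(3)[OF t xk] by (simp add: \<delta>_def H_def k eval_nat_numeral)
  have top0: "\<delta> 0 = t + 1 - t / \<delta> 1"
    using pivot_identities(4)[OF t xk] by (simp add: \<delta>_def H_def k eval_nat_numeral)
  have tail: "H i / H (Suc i) = t + 1 - t * (H (Suc (Suc i)) / H (Suc i))"
    "(if i < n - 3 then t / \<delta> (Suc i) else if i = n - 3 then 2 * t / (t + 1) else 0) =
      t * (H (Suc (Suc i)) / H (Suc i))"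
    if "0 < i" "i < n - 2" for i
  proof -
    have H': "H = (\<lambda>i. t ^ (n - 2 + 1 - i) + 1)" using n by (simp add: H_def)
    show "H i / H (Suc i) = t + 1 - t * (H (Suc (Suc i)) / H (Suc i))"
      using tail_ratio(1)[OF t that(2)] unfolding H' .
    show "(if i < n - 3 then t / \<delta> (Suc i) else if i = n - 3 then 2 * t / (t + 1) else 0) =
      t * (H (Suc (Suc i)) / H (Suc i))"
    proof (cases "Suc i = n - 2")
      case True
      have "2 * t / (t + 1) = t * (H (Suc (Suc i)) / H (Suc i))"
        using tail_ratio(2)[OF t that(2) True] unfolding H' .
      moreover have "i = n - 3" using True by simp
      ultimately show ?thesis by simp
    next
      case False
      then have "i < n - 3" "Suc i < n - 2" using that by simp_all
      then show ?thesis using that by (simp add: \<delta>_def)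
    qed
  qed
  have "\<delta> i = t + 1 - (\<Sum>(u, v, a, b)\<leftarrow>?E. if u = i then t * (of_int a * of_int b) / \<delta> v else 0)"
    if "i < n + 1" for i
  proof -
    have *: "(\<Sum>(u, v, a, b)\<leftarrow>?E. if u = i then t * (of_int a * of_int b) / \<delta> v else 0) =
      (if i < n - 3 then t / \<delta> (Suc i) else if i = n - 3 then 2 * t / (t + 1) else 0) + (if i = 1 then t / (t + 1) else 0)"
      using n that by (auto simp: sum_list_chain \<delta>_def)
    have "i = 0 \<or> i = 1 \<or> 1 < i \<and> i < n - 2 \<or> n - 2 \<le> i" by linarith
    then consider "i = 0" | "i = 1" | "1 < i" "i < n - 2" | "n - 2 \<le> i" by blast
    then show ?thesis
    proof cases
      case 1
      then show ?thesis unfolding * using n top0 by simp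
    next
      case 2
      have Suc: "Suc 1 = 2" "Suc 2 = 3" by simp_all
      have head: "(if 1 < n - 3 then t / \<delta> 2 else if 1 = n - 3 then 2 * t / (t + 1) else 0) =
          t * (H 3 / H 2)"
        by (rule tail(2)[of 1, unfolded Suc]) (use n in simp_all)
      show ?thesis unfolding * unfolding 2 Suc head top1 by simp
    next
      case 3
      then have "\<delta> i = t + 1 - t * (H (Suc (Suc i)) / H (Suc i))" using tail(1)[of i] by (simp add: \<delta>_def)
      then show ?thesis unfolding * using tail(2)[of i] 3 by simp
    next
      case 4
      then have "i \<noteq> 0" "i \<noteq> 1" "\<not> i < n - 2" "\<not> i < n - 3" "i \<noteq> n - 3" using n by simp_all
      then show ?thesis unfolding * by (simp add: \<delta>_def)
    qed
  qed
  moreover have "\<delta> i \<noteq> 0" if "0 < i" for i using that nz t by (simp add: \<delta>_def)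
  ultimately have "pivot_family (n + 1) ?E (t + 1) t \<delta>"
    unfolding pivot_family_def by blast
  moreover have "(\<Prod>i<n + 1. \<delta> i) = (t - 1)\<^sup>2 * (\<Sum>i<n - 2. t ^ i) * (t + 1)\<^sup>2"
  proof -
    have "{..<n + 1} = insert 0 (insert 1 (insert (n - 2) (insert (n - 1) (insert n {2..<n - 2}))))" using n by auto
    moreover have ne: "n - 1 \<noteq> 0" "n - 1 \<noteq> 1" "n - 1 \<noteq> n" "n - 2 \<noteq> 0" "n - 2 \<noteq> 1" "n - 2 \<noteq> n - 1"
      "n - 2 \<noteq> n" "\<not> n - 1 < n - 2"
      using n by simp_all
    ultimately have "(\<Prod>i<n + 1. \<delta> i) = \<delta> 0 * (\<delta> 1 * (\<delta> (n - 2) * (\<delta> (n - 1) * (\<delta> n * (\<Prod>i = 2..<n - 2. \<delta> i)))))"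
      using n by simp
    also have "(\<Prod>i = 2..<n - 2. \<delta> i) = (\<Prod>i = 2..<n - 2. H i / H (Suc i))"
      by (rule prod.cong) (auto simp: \<delta>_def)
    also have "\<dots> = H 2 / H (n - 2)" using n nz by (intro prod_telescope_ratio) auto
    also have "\<dots> = H 2 / (t + 1)" using n by (simp add: H_def)
    also have "\<delta> 0 * (\<delta> 1 * (\<delta> (n - 2) * (\<delta> (n - 1) * (\<delta> n * \<dots>)))) = (t + 1)\<^sup>2 * ((t - 1) * (t ^ (n - 2) - 1))"
      using n nz[of 0] nz[of 2] t ne by (simp add: \<delta>_def power2_eq_square)
    finally show ?thesis by (simp add: power_diff_1_eq power2_eq_square)
  qed
  ultimately show ?thesis by blast
qed

section \<open>Pivots of the exceptional diagrams\<close>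

lemma all_less_conv_list: "(\<forall>i<N. P i) \<longleftrightarrow> list_all P [0..<N]"
  by (auto simp: list_all_iff)

lemma prod_less_conv_list: "(\<Prod>i<N. f i) = (\<Prod>i\<leftarrow>[0..<N]. f i :: 'a :: comm_monoid_mult)"
  by (metis atLeast_upt distinct_upt prod.distinct_set_conv_list)

text \<open>
  Factors of the Coxeter polynomials of the finite diagrams that occur as proper subtrees in the
  exceptional cases. Their roots lie on the unit circle, which keeps the pivots nonzero for \<open>t > 1\<close>.
\<close>

lemma positive_polynomials:
  fixes t :: real
  assumes t: "t > 1"
  shows "t + 1 > 0" "t\<^sup>2 + t + 1 > 0" "t ^ 3 + t\<^sup>2 + t + 1 > 0" "t ^ 4 + t ^ 3 + t\<^sup>2 + t + 1 > 0"
   "t ^ 5 + t ^ 4 + t ^ 3 + t\<^sup>2 + t + 1 > 0"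
   "t ^ 7 + t ^ 6 + t ^ 5 + t ^ 4 + t ^ 3 + t\<^sup>2 + t + 1 > 0"
   "t ^ 3 + 1 > 0" "t ^ 5 + 1 > 0" "t ^ 7 + 1 > 0"
   "t\<^sup>2 - t + 1 > 0" "t ^ 4 - t\<^sup>2 + 1 > 0" "t ^ 6 - t ^ 3 + 1 > 0"
proof -
  have "t ^ i < t ^ j" if "i < j" for i j using power_strict_increasing[OF that t] .
  from this[of 1 2] this[of 2 4] this[of 3 6]
  have lt: "t < t\<^sup>2" "t\<^sup>2 < t ^ 4" "t ^ 3 < t ^ 6" by simp_all
  have p: "t ^ k > 0" for k using t by simp
  note ps = p[of 2] p[of 3] p[of 4] p[of 5] p[of 6] p[of 7]
  show "t + 1 > 0" "t\<^sup>2 + t + 1 > 0" "t ^ 3 + t\<^sup>2 + t + 1 > 0" "t ^ 4 + t ^ 3 + t\<^sup>2 + t + 1 > 0"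
   "t ^ 5 + t ^ 4 + t ^ 3 + t\<^sup>2 + t + 1 > 0"
   "t ^ 7 + t ^ 6 + t ^ 5 + t ^ 4 + t ^ 3 + t\<^sup>2 + t + 1 > 0"
   "t ^ 3 + 1 > 0" "t ^ 5 + 1 > 0" "t ^ 7 + 1 > 0"
   "t\<^sup>2 - t + 1 > 0" "t ^ 4 - t\<^sup>2 + 1 > 0" "t ^ 6 - t ^ 3 + 1 > 0"
    using t lt ps by linarith+
qed

context
  fixes t :: real
  assumes t: "t > 1"
begin

lemmas poly_nz = positive_polynomials[OF t, THEN less_imp_neq, THEN not_sym]

lemma pivots_A:
  assumes "a * b = 4"
  shows "\<exists>\<delta>. pivot_family 2 [(0, 1, a, b)] (t + 1) t \<delta> \<and>
    (\<Prod>i<2. \<delta> i) = (t - 1)\<^sup>2"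
proof -
  have ab: "of_int a * of_int b = (4 :: real)" using assms by (metis of_int_mult of_int_numeral)
  define \<delta> where "\<delta> = (!) [(t - 1)\<^sup>2 / (t + 1),
     t + 1]"
  have "pivot_family 2 [(0, 1, a, b)] (t + 1) t \<delta>"
    unfolding pivot_family_def all_less_conv_list \<delta>_def
    by (simp add: chain_def upt_rec poly_nz ab)
      ((intro conjI)?; simp add: divide_simps poly_nz; simp add: algebra_simps eval_nat_numeral)
  moreover have "(\<Prod>i<2. \<delta> i) = (t - 1)\<^sup>2"
    unfolding prod_less_conv_list \<delta>_def
    by (simp add: upt_rec poly_nz; (simp add: divide_simps poly_nz)?;
        simp add: algebra_simps eval_nat_numeral)
  ultimately show ?thesis by blast
qed

lemma pivots_G:
  assumes "a * b = 3"
  shows "\<exists>\<delta>. pivot_family 3 [(0, 1, 1, 1), (1, 2, a, b)] (t + 1) t \<delta> \<and>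
    (\<Prod>i<3. \<delta> i) = (t - 1)\<^sup>2 * (t + 1)"
proof -
  have ab: "of_int a * of_int b = (3 :: real)" using assms by (metis of_int_mult of_int_numeral)
  define \<delta> where "\<delta> = (!) [(t - 1)\<^sup>2 * (t + 1) / (t\<^sup>2 - t + 1),
     (t\<^sup>2 - t + 1) / (t + 1),
     t + 1]"
  have "pivot_family 3 [(0, 1, 1, 1), (1, 2, a, b)] (t + 1) t \<delta>"
    unfolding pivot_family_def all_less_conv_list \<delta>_def
    by (simp add: chain_def upt_rec poly_nz ab)
      ((intro conjI)?; simp add: divide_simps poly_nz; simp add: algebra_simps eval_nat_numeral)
  moreover have "(\<Prod>i<3. \<delta> i) = (t - 1)\<^sup>2 * (t + 1)"
    unfolding prod_less_conv_list \<delta>_def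
    by (simp add: upt_rec poly_nz; (simp add: divide_simps poly_nz)?;
        simp add: algebra_simps eval_nat_numeral)
  ultimately show ?thesis by blast
qed

lemma pivots_F:
  assumes "a * b = 2"
  shows "\<exists>\<delta>. pivot_family 5 [(0, 1, 1, 1), (1, 2, 1, 1), (2, 3, a, b), (3, 4, 1, 1)] (t + 1) t \<delta> \<and>
    (\<Prod>i<5. \<delta> i) = (t - 1)\<^sup>2 * (t\<^sup>2 + t + 1) * (t + 1)"
proof -
  have ab: "of_int a * of_int b = (2 :: real)" using assms by (metis of_int_mult of_int_numeral)
  define \<delta> where "\<delta> = (!) [(t ^ 3 - 1) * (t\<^sup>2 - 1) / (t ^ 4 - t\<^sup>2 + 1),
     (t ^ 4 - t\<^sup>2 + 1) / (t ^ 3 + 1),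
     (t ^ 3 + 1) / (t\<^sup>2 + t + 1),
     (t\<^sup>2 + t + 1) / (t + 1),
     t + 1]"
  have "pivot_family 5 [(0, 1, 1, 1), (1, 2, 1, 1), (2, 3, a, b), (3, 4, 1, 1)] (t + 1) t \<delta>"
    unfolding pivot_family_def all_less_conv_list \<delta>_def
    by (simp add: chain_def upt_rec poly_nz ab)
      ((intro conjI)?; simp add: divide_simps poly_nz; simp add: algebra_simps eval_nat_numeral)
  moreover have "(\<Prod>i<5. \<delta> i) = (t - 1)\<^sup>2 * (t\<^sup>2 + t + 1) * (t + 1)"
    unfolding prod_less_conv_list \<delta>_def
    by (simp add: upt_rec poly_nz; (simp add: divide_simps poly_nz)?;
        simp add: algebra_simps eval_nat_numeral)
  ultimately show ?thesis by blast
qed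

text \<open>
  The diagram folds onto the preceding one: two equal arms with simple edges subtract from the pivot of
  vertex \<open>2\<close> what one arm behind a double edge subtracts there, so the upper pivots are the same.
\<close>

lemma pivots_E6:
  "\<exists>\<delta>. pivot_family 7 (edges tE6) (t + 1) t \<delta> \<and>
    (\<Prod>i<7. \<delta> i) = (t - 1)\<^sup>2 * (t\<^sup>2 + t + 1)\<^sup>2 * (t + 1)"
proof -
  define \<delta> where "\<delta> = (!) [(t ^ 3 - 1) * (t\<^sup>2 - 1) / (t ^ 4 - t\<^sup>2 + 1),
     (t ^ 4 - t\<^sup>2 + 1) / (t ^ 3 + 1),
     (t ^ 3 + 1) / (t\<^sup>2 + t + 1),
     (t\<^sup>2 + t + 1) / (t + 1),
     t + 1,
     (t\<^sup>2 + t + 1) / (t + 1),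
     t + 1]"
  have "pivot_family 7 (edges tE6) (t + 1) t \<delta>"
    unfolding pivot_family_def all_less_conv_list \<delta>_def
    by (simp add: chain_def upt_rec poly_nz)
      ((intro conjI)?; simp add: divide_simps poly_nz; simp add: algebra_simps eval_nat_numeral)
  moreover have "(\<Prod>i<7. \<delta> i) = (t - 1)\<^sup>2 * (t\<^sup>2 + t + 1)\<^sup>2 * (t + 1)"
    unfolding prod_less_conv_list \<delta>_def
    by (simp add: upt_rec poly_nz; (simp add: divide_simps poly_nz)?;
        simp add: algebra_simps eval_nat_numeral)
  ultimately show ?thesis by blast
qed

text \<open>
  The subtrees below the vertices \<open>1, 2, \<dots>\<close> are of the finite types
  \<open>E\<^sub>7, D\<^sub>6, A\<^sub>5, A\<^sub>3, A\<^sub>2, A\<^sub>1, A\<^sub>1\<close>.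
\<close>

lemma pivots_E7:
  "\<exists>\<delta>. pivot_family 8 (edges tE7) (t + 1) t \<delta> \<and>
    (\<Prod>i<8. \<delta> i) = (t - 1)\<^sup>2 * (t\<^sup>2 + t + 1) * (t ^ 3 + t\<^sup>2 + t + 1) * (t + 1)"
proof -
  define \<delta> where "\<delta> = (!) [(t ^ 4 - 1) * (t ^ 3 - 1) / (t ^ 6 - t ^ 3 + 1),
     (t ^ 6 - t ^ 3 + 1) / (t ^ 5 + 1),
     (t ^ 5 + 1) * (t + 1) / (t ^ 5 + t ^ 4 + t ^ 3 + t\<^sup>2 + t + 1),
     (t ^ 5 + t ^ 4 + t ^ 3 + t\<^sup>2 + t + 1) / ((t ^ 3 + t\<^sup>2 + t + 1) * (t + 1)),
     (t ^ 3 + t\<^sup>2 + t + 1) / (t\<^sup>2 + t + 1),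
     (t\<^sup>2 + t + 1) / (t + 1),
     t + 1,
     t + 1]"
  have "pivot_family 8 (edges tE7) (t + 1) t \<delta>"
    unfolding pivot_family_def all_less_conv_list \<delta>_def
    by (simp add: chain_def upt_rec poly_nz)
      ((intro conjI)?; simp add: divide_simps poly_nz; simp add: algebra_simps eval_nat_numeral)
  moreover have "(\<Prod>i<8. \<delta> i) = (t - 1)\<^sup>2 * (t\<^sup>2 + t + 1) * (t ^ 3 + t\<^sup>2 + t + 1) * (t + 1)"
    unfolding prod_less_conv_list \<delta>_def
    by (simp add: upt_rec poly_nz; (simp add: divide_simps poly_nz)?;
        simp add: algebra_simps eval_nat_numeral)
  ultimately show ?thesis by blast
qed

text \<open>
  The subtrees below the vertices \<open>1, 2, \<dots>\<close> are of the finite types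
  \<open>D\<^sub>8, A\<^sub>7, A\<^sub>5, A\<^sub>4, A\<^sub>3, A\<^sub>2, A\<^sub>1, A\<^sub>1\<close>.
\<close>

lemma pivots_E8:
  "\<exists>\<delta>. pivot_family 9 (edges tE8) (t + 1) t \<delta> \<and>
    (\<Prod>i<9. \<delta> i) = (t - 1)\<^sup>2 * (t\<^sup>2 + t + 1) * (t ^ 4 + t ^ 3 + t\<^sup>2 + t + 1) * (t + 1)"
proof -
  define \<delta> where "\<delta> = (!) [(t ^ 3 - 1) * (t ^ 5 - 1) / (t ^ 7 + 1),
     (t ^ 7 + 1) * (t + 1) / (t ^ 7 + t ^ 6 + t ^ 5 + t ^ 4 + t ^ 3 + t\<^sup>2 + t + 1),
     (t ^ 7 + t ^ 6 + t ^ 5 + t ^ 4 + t ^ 3 + t\<^sup>2 + t + 1) / ((t ^ 5 + t ^ 4 + t ^ 3 + t\<^sup>2 + t + 1) * (t + 1)),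
     (t ^ 5 + t ^ 4 + t ^ 3 + t\<^sup>2 + t + 1) / (t ^ 4 + t ^ 3 + t\<^sup>2 + t + 1),
     (t ^ 4 + t ^ 3 + t\<^sup>2 + t + 1) / (t ^ 3 + t\<^sup>2 + t + 1),
     (t ^ 3 + t\<^sup>2 + t + 1) / (t\<^sup>2 + t + 1),
     (t\<^sup>2 + t + 1) / (t + 1),
     t + 1,
     t + 1]"
  have "pivot_family 9 (edges tE8) (t + 1) t \<delta>"
    unfolding pivot_family_def all_less_conv_list \<delta>_def
    by (simp add: chain_def upt_rec poly_nz)
      ((intro conjI)?; simp add: divide_simps poly_nz; simp add: algebra_simps eval_nat_numeral)
  moreover have "(\<Prod>i<9. \<delta> i) = (t - 1)\<^sup>2 * (t\<^sup>2 + t + 1) * (t ^ 4 + t ^ 3 + t\<^sup>2 + t + 1) * (t + 1)"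
    unfolding prod_less_conv_list \<delta>_def
    by (simp add: upt_rec poly_nz; (simp add: divide_simps poly_nz)?;
        simp add: algebra_simps eval_nat_numeral)
  ultimately show ?thesis by blast
qed

end

section \<open>Products of cyclotomic factors\<close>

text \<open>
  The product \<open>(x - 1) geom_poly p\<close> is \<open>x\<^sup>p - 1\<close>, so the roots of \<open>geom_poly p\<close> are the nontrivial \<open>p\<close>-th roots of
  unity.
\<close>

definition geom_poly :: "nat \<Rightarrow> 'a :: comm_ring_1 poly" where
  "geom_poly p = (\<Sum>i<p. [:0, 1:] ^ i)"

definition coxeter_poly :: "nat list \<Rightarrow> 'a :: comm_ring_1 poly" where
  "coxeter_poly ps = [:-1, 1:]\<^sup>2 * (\<Prod>p\<leftarrow>ps. geom_poly p)"

lemma poly_coxeter_poly: "poly (coxeter_poly ps) t = (t - 1)\<^sup>2 * (\<Prod>p\<leftarrow>ps. \<Sum>i<p. t ^ i)"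
proof -
  have "poly (\<Prod>p\<leftarrow>ps. geom_poly p) t = (\<Prod>p\<leftarrow>ps. \<Sum>i<p. t ^ i)"
    by (induction ps) (simp_all add: geom_poly_def poly_sum)
  then show ?thesis by (simp only: coxeter_poly_def poly_mult poly_power) simp
qed

lemma map_poly_of_int_coxeter_poly:
  "map_poly (of_int :: int \<Rightarrow> 'a :: {comm_ring_1, ring_char_0}) (coxeter_poly ps) = coxeter_poly ps"
proof -
  have "map_poly (of_int :: int \<Rightarrow> 'a) (\<Prod>p\<leftarrow>ps. geom_poly p) = (\<Prod>p\<leftarrow>ps. geom_poly p)"
    by (induction ps) (simp_all add: geom_poly_def hom_distribs)
  then show ?thesis by (simp add: coxeter_poly_def hom_distribs)
qed

lemma linear_mult_geom_poly: "[:-1, 1:] * geom_poly p = ([:0, 1:] ^ p - 1 :: 'a :: comm_ring_1 poly)"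
proof -
  have "[:-1, 1:] = ([:0, 1:] - 1 :: 'a poly)" by (simp add: one_pCons)
  then show ?thesis by (simp only: geom_poly_def power_diff_1_eq)
qed

text \<open>
  There are \<open>n\<close> distinct roots of unity and the degree is \<open>n\<close>, so all roots are simple.
\<close>

lemma proots_power_minus_one:
  assumes "n > 0"
  shows "proots ([:0, 1:] ^ n - 1 :: complex poly) = mset_set {z. z ^ n = 1}"
proof -
  let ?P = "[:0, 1:] ^ n - 1 :: complex poly"
  have "degree ([:0, 1:] ^ n :: complex poly) = n"
    using degree_power_eq[of "[:0, 1 :: complex:]" n] by simp
  then have deg: "degree ?P = n"
    using assms degree_add_eq_left[of "- 1" "[:0, 1:] ^ n :: complex poly"] by simp
  then have nz: "?P \<noteq> 0" using assms by auto
  have set: "set_mset (proots ?P) = {z. z ^ n = 1}" using nz by (auto)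
  have "mset_set (set_mset (proots ?P)) \<subseteq># proots ?P" by (rule mset_set_set_mset_msubset)
  moreover have "size (mset_set {z :: complex. z ^ n = 1}) = size (proots ?P)"
    using assms by (simp add: size_proots_complex deg card_roots_unity_eq)
  ultimately show ?thesis unfolding set by (metis mset_subset_size nless_le subset_mset.nless_le)
qed

lemma proots_geom_poly:
  assumes "p > 0"
  shows "proots (geom_poly p) = {#cis (2 * real s * pi / real p). s \<in># mset_set {1..p - 1}#}"
proof -
  let ?f = "\<lambda>s. cis (2 * real s * pi / real p)"
  have bij: "bij_betw ?f {..<p} {z. z ^ p = 1}"
    using bij_betw_roots_unity[OF assms] by (simp add: mult_ac)
  have nz: "[:-1, 1:] * geom_poly p \<noteq> (0 :: complex poly)"
  proof
    assume "[:-1, 1:] * geom_poly p = (0 :: complex poly)"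
    then have "poly ([:0, 1:] ^ p - 1 :: complex poly) 0 = 0" by (simp only: linear_mult_geom_poly poly_0)
    then show False using assms by (simp add: power_0_left)
  qed
  have "{#1#} + proots (geom_poly p) = proots ([:-1, 1:] * geom_poly p :: complex poly)"
    using nz by (subst proots_mult) auto
  also have "\<dots> = mset_set {z. z ^ p = 1}"
    using proots_power_minus_one[OF assms] by (simp only: linear_mult_geom_poly)
  also have "\<dots> = image_mset ?f (mset_set {..<p})"
    using bij image_mset_mset_set[of ?f "{..<p}"] by (simp add: bij_betw_def)
  also have "{..<p} = insert 0 {1..p - 1}" using assms by auto
  also have "image_mset ?f (mset_set (insert 0 {1..p - 1})) = {#1#} + image_mset ?f (mset_set {1..p - 1})"
    by simp
  finally show ?thesis by simp
qed

lemma proots_coxeter_poly: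
  assumes "\<forall>p \<in> set ps. p > 0"
  shows "proots (coxeter_poly ps) = {#1, 1#} +
    (\<Sum>p\<leftarrow>ps. {#cis (2 * real s * pi / real p). s \<in># mset_set {1..p - 1}#})"
proof -
  have nz: "geom_poly p \<noteq> (0 :: complex poly)" if "p > 0" for p
  proof
    assume "geom_poly p = (0 :: complex poly)"
    then have "poly (geom_poly p :: complex poly) 1 = 0" by simp
    with that show False by (simp add: geom_poly_def poly_sum)
  qed
  have "(\<Prod>p\<leftarrow>ps. geom_poly p) \<noteq> (0 :: complex poly) \<and> proots (\<Prod>p\<leftarrow>ps. geom_poly p) =
    (\<Sum>p\<leftarrow>ps. {#cis (2 * real s * pi / real p). s \<in># mset_set {1..p - 1}#})"
    using assms by (induction ps) (auto simp: nz proots_mult proots_geom_poly)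
  moreover have "proots ([:-1, 1 :: complex:]\<^sup>2) = {#1, 1#}"
    by (simp only: proots_power proots_linear_factor) (simp add: numeral_2_eq_2)
  ultimately show ?thesis unfolding coxeter_poly_def by (subst proots_mult) auto
qed

lemma root_coxeter_poly:
  fixes z :: "'a :: idom"
  assumes "\<forall>p \<in> set ps. p > 0" and "poly (coxeter_poly ps) z = 0"
  shows "\<exists>m > 0. z ^ m = 1"
proof (cases "z = 1")
  case False
  then obtain p where p: "p \<in> set ps" "(\<Sum>i<p. z ^ i) = 0"
    using assms(2) by (auto simp: poly_coxeter_poly prod_list_zero_iff)
  then have "z ^ p - 1 = 0" by (simp add: power_diff_1_eq)
  then show ?thesis using p(1) assms(1) by auto
qed (auto intro: exI[of _ 1])

text \<open>
  The roots of unity of small order with angles in the interval from \<open>- pi\<close> to \<open>pi\<close>.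
\<close>

lemma proots_small:
  "{#cis (2 * real s * pi / 2). s \<in># mset_set {1..1}#} = {#- 1#}"
  "{#cis (2 * real s * pi / 3). s \<in># mset_set {1..2}#} = {#cis (2 * pi / 3), cis (- (2 * pi / 3))#}"
  "{#cis (2 * real s * pi / 4). s \<in># mset_set {1..3}#} = {#cis (pi / 2), - 1, cis (- (pi / 2))#}"
  "{#cis (2 * real s * pi / 5). s \<in># mset_set {1..4}#} =
     {#cis (2 * pi / 5), cis (4 * pi / 5), cis (- (4 * pi / 5)), cis (- (2 * pi / 5))#}"
proof -
  have shift: "cis x = cis y" if "x = y + 2 * pi" for x y
    using that by (simp add: cis_mult[symmetric])
  have sets: "{1..1} = {1 :: nat}" "{1..2} = {1, 2 :: nat}" "{1..3} = {1, 2, 3 :: nat}" "{1..4} = {1, 2, 3, 4 :: nat}"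
    by auto
  have "cis (4 * pi / 3) = cis (- (2 * pi / 3))" "cis (pi * 3 / 2) = cis (- (pi / 2))"
    "cis (6 * pi / 5) = cis (- (4 * pi / 5))" "cis (8 * pi / 5) = cis (- (2 * pi / 5))"
    by (rule shift; simp add: field_simps)+
  then show "{#cis (2 * real s * pi / 2). s \<in># mset_set {1..1}#} = {#- 1#}"
  "{#cis (2 * real s * pi / 3). s \<in># mset_set {1..2}#} = {#cis (2 * pi / 3), cis (- (2 * pi / 3))#}"
  "{#cis (2 * real s * pi / 4). s \<in># mset_set {1..3}#} = {#cis (pi / 2), - 1, cis (- (pi / 2))#}"
  "{#cis (2 * real s * pi / 5). s \<in># mset_set {1..4}#} =
     {#cis (2 * pi / 5), cis (4 * pi / 5), cis (- (4 * pi / 5)), cis (- (2 * pi / 5))#}"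
    unfolding sets by simp_all
qed

section \<open>The Coxeter polynomials of the extended Dynkin trees\<close>

text \<open>
  The extended diagrams \<open>tD n\<close>, \<open>tE6\<close>, \<open>tE7\<close>, \<open>tE8\<close> belong to the finite diagrams \<open>D\<^sub>n\<close>, \<open>E\<^sub>6\<close>, \<open>E\<^sub>7\<close>, \<open>E\<^sub>8\<close>,
  which are stars; listed are the lengths of the arms of the star, with the centre counted in each of them.
  The lists of the diagrams with multiple edges play the same role in the Coxeter polynomial.
  The value at \<open>tA n\<close> is a dummy.
\<close>

fun arms :: "ext_dynkin \<Rightarrow> nat list" where
  "arms (tD n) = [n - 2, 2, 2]"
| "arms tE6 = [3, 3, 2]"
| "arms tE7 = [3, 4, 2]"
| "arms tE8 = [3, 5, 2]"
| "arms tG21 = [2]"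
| "arms tG22 = [2]"
| "arms tF41 = [3, 2]"
| "arms tF42 = [3, 2]"
| "arms tA11 = []"
| "arms tA12 = []"
| "arms (tB n) = [n]"
| "arms (tC n) = [n]"
| "arms (tBC n) = [n]"
| "arms (tCD n) = [n - 1, 2]"
| "arms (tDD n) = [n - 1, 2]"
| "arms (tA n) = []"

lemma arms_pos: "ext_dynkin_range X \<Longrightarrow> p \<in> set (arms X) \<Longrightarrow> p > 0"
  by (cases X) auto

lemma ex_pivot_family:
  fixes t :: real
  assumes "ext_dynkin_range X" "\<And>n. X \<noteq> tA n" and t: "t > 1"
  shows "\<exists>\<delta>. pivot_family (num_vertices X) (edges X) (t + 1) t \<delta> \<and>
    (\<Prod>i<num_vertices X. \<delta> i) = poly (coxeter_poly (arms X)) t"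
proof -
  have sums: "(\<Sum>i<2. t ^ i) = t + 1" "(\<Sum>i<3. t ^ i) = t\<^sup>2 + t + 1"
    "(\<Sum>i<4. t ^ i) = t ^ 3 + t\<^sup>2 + t + 1" "(\<Sum>i<5. t ^ i) = t ^ 4 + t ^ 3 + t\<^sup>2 + t + 1"
    by (simp_all add: eval_nat_numeral)
  note star = poly_coxeter_poly sums power2_eq_square[of "t + 1"] power2_eq_square[of "t\<^sup>2 + t + 1"] mult.assoc
  show ?thesis
  proof (cases X)
    case (tD n)
    then show ?thesis using pivots_fork_fork[OF t, of n] assms(1) by (simp add: star)
  next
    case (tB n)
    then show ?thesis using pivots_double_double[OF t, of n 2 1 1 2] assms(1) by (simp add: star)
  next
    case (tC n)
    then show ?thesis using pivots_double_double[OF t, of n 1 2 2 1] assms(1) by (simp add: star)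
  next
    case (tBC n)
    then show ?thesis using pivots_double_double[OF t, of n 2 1 2 1] assms(1) by (simp add: star)
  next
    case (tCD n)
    then show ?thesis using pivots_fork_double[OF t, of n 1 2] assms(1) by (simp add: star)
  next
    case (tDD n)
    then show ?thesis using pivots_fork_double[OF t, of n 2 1] assms(1) by (simp add: star)
  next
    case tE6
    then show ?thesis using pivots_E6[OF t] by (simp add: star)
  next
    case tE7
    then show ?thesis using pivots_E7[OF t] by (simp add: star)
  next
    case tE8
    then show ?thesis using pivots_E8[OF t] by (simp add: star)
  next
    case tG21
    then show ?thesis using pivots_G[OF t, of 3 1] by (simp add: star)
  next
    case tG22
    then show ?thesis using pivots_G[OF t, of 1 3] by (simp add: star)
  next
    case tF41
    then show ?thesis using pivots_F[OF t, of 2 1] by (simp add: star)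
  next
    case tF42
    then show ?thesis using pivots_F[OF t, of 1 2] by (simp add: star)
  next
    case tA11
    then show ?thesis using pivots_A[OF t, of 4 1] by (simp add: star)
  next
    case tA12
    then show ?thesis using pivots_A[OF t, of 2 2] by (simp add: star)
  next
    case (tA n)
    then show ?thesis using assms(2) by blast
  qed
qed

lemma downward_edges_edges:
  assumes "ext_dynkin_range X" "\<And>n. X \<noteq> tA n"
  shows "downward_edges (num_vertices X) (edges X)"
proof -
  have "map (\<lambda>(u, v, a, b). v) (chain x y) = map Suc [x..<y]" for x y
    by (simp add: chain_def)
  then show ?thesis using assms
    by (cases X) (auto simp: downward_edges_def set_chain distinct_map)
qed

text \<open>
  A renumbering of the vertices preserves cycles, so the cycle of \<open>tA n\<close> is found in every matrix of this type.
\<close>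

lemma graph_cycle_map:
  assumes "graph_cycle K vs" "inj q" "\<And>i j. adjacent K i j \<Longrightarrow> adjacent K' (q i) (q j)"
  shows "graph_cycle K' (map q vs)"
proof -
  have "vs \<noteq> []" using assms(1) by (auto simp: graph_cycle_def)
  then show ?thesis using assms
    by (auto simp: graph_cycle_def distinct_map successively_map hd_map last_map
        intro: inj_on_subset successively_mono)
qed

lemma not_is_tree_diagram_tA:
  assumes "has_diagram K (tA n)"
  shows "\<not> is_tree K"
proof -
  obtain p where n: "n \<ge> 2" and K: "K \<in> carrier_mat (n + 1) (n + 1)" and p: "p permutes {..<n + 1}"
    and eq: "\<forall>i < n + 1. \<forall>j < n + 1. K $$ (i, j) = cartan_matrix (tA n) $$ (p i, p j)"
    using assms by (auto simp: has_diagram_def)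
  let ?q = "inv_into UNIV p"
  have q: "?q permutes {..<n + 1}" using p by (rule permutes_inv)
  have lt: "?q i < n + 1" if "i < n + 1" for i using permutes_in_image[OF q, of i] that by simp
  have "graph_cycle (cartan_matrix (tA n)) [0..<n + 1]"
    using n by (auto simp: graph_cycle_def adjacent_cartan_matrix set_chain
        successively_conv_nth hd_upt simp del: upt_Suc)
  then have "graph_cycle K (map ?q [0..<n + 1])"
  proof (rule graph_cycle_map)
    show "inj ?q" using q by (rule permutes_inj)
    fix i j assume *: "adjacent (cartan_matrix (tA n)) i j"
    have "dim_row (cartan_matrix (tA n)) = n + 1" by (simp add: cartan_matrix_def cartan_of_edges_def)
    then show "adjacent K (?q i) (?q j)"
      using * K eq lt permutes_inj[OF q] by (auto simp: adjacent_def inj_eq permutes_inverses[OF p])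
  qed
  then show ?thesis by (auto simp: is_tree_def)
qed

text \<open>
  Both polynomials agree at all real \<open>t > 1\<close>. There
  \<open>det (t - C) = det (L (t - C)) = det (t L + U)\<close> is the product of the pivots; that \<open>det L = 1\<close> is an instance of the
  same elimination, because the product of opposite entries of \<open>L\<close> vanishes and all pivots are \<open>1\<close>.
\<close>

lemma char_poly_coxeter_transformation:
  assumes X: "has_diagram K X" "\<And>n. X \<noteq> tA n" and vs: "vertex_order K vs"
  shows "char_poly (coxeter_transformation K vs) = coxeter_poly (arms X)"
proof -
  define N where "N = num_vertices X"
  obtain p where r: "ext_dynkin_range X" and K: "K \<in> carrier_mat N N" and p: "p permutes {..<N}"
    and eq: "\<And>i j. i < N \<Longrightarrow> j < N \<Longrightarrow> K $$ (i, j) = cartan_of_edges N (edges X) $$ (p i, p j)"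
    using X by (auto simp: has_diagram_def N_def cartan_matrix_def)
  let ?C = "coxeter_transformation K vs" and ?h = "of_int :: int \<Rightarrow> real"
  have C: "?C \<in> carrier_mat N N" using K by simp
  have lt: "p i < N" if "i < N" for i using permutes_in_image[OF p, of i] that by simp
  have diag: "K $$ (i, i) = 2" if "i < N" for i using that lt by (simp add: eq cartan_of_edges_def)
  have E: "downward_edges N (edges X)" unfolding N_def using r X(2) by (rule downward_edges_edges)
  note det = det_oriented_mat[OF E K p eq vs]
  have "poly (map_poly ?h (char_poly ?C)) t = poly (map_poly ?h (coxeter_poly (arms X))) t" if t: "t > 1" for t
  proof -
    obtain \<delta> where \<delta>: "pivot_family N (edges X) (t + 1) t \<delta>"
      "(\<Prod>i<N. \<delta> i) = poly (coxeter_poly (arms X)) t"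
      using ex_pivot_family[OF r X(2) t] unfolding N_def by blast
    let ?A = "- char_matrix (map_mat ?h ?C) t"
    have A: "?A \<in> carrier_mat N N" using C by simp
    have L: "oriented_mat K vs 1 1 0 \<in> carrier_mat N N" using K by (simp add: oriented_mat_def)
    have "det (oriented_mat K vs 1 1 (0 :: real)) = (\<Prod>i<N. 1)"
      by (rule det) (simp_all add: pivot_family_def case_prod_unfold cong: if_cong)
    then have "det ?A = det (oriented_mat K vs 1 1 0 * ?A)"
      using det_mult[OF L A] by simp
    also have "\<dots> = det (oriented_mat K vs (t + 1) t 1)"
      using lower_part_mult_char_matrix[OF K diag vs, of t] by simp
    also have "\<dots> = (\<Prod>i<N. \<delta> i)"
      by (rule det) (use \<delta>(1) in simp_all)
    finally have "poly (char_poly (map_mat ?h ?C)) t = poly (coxeter_poly (arms X)) t"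
      using \<delta>(2) char_poly_matrix[of "map_mat ?h ?C" N t] C by simp
    then show ?thesis
      by (simp add: of_int_hom.char_poly_hom[OF C] map_poly_of_int_coxeter_poly)
  qed
  then have "{1<..} \<subseteq> {t. poly (map_poly ?h (char_poly ?C) - map_poly ?h (coxeter_poly (arms X))) t = 0}"
    by auto
  then have "map_poly ?h (char_poly ?C) = map_poly ?h (coxeter_poly (arms X))"
    using poly_roots_finite[of "map_poly ?h (char_poly ?C) - map_poly ?h (coxeter_poly (arms X))"]
      infinite_Ioi[of "1 :: real"] finite_subset by auto
  then show ?thesis by simp
qed

theorem theorem4p1:
  fixes X :: ext_dynkin and K :: "int mat" and vs :: "nat list"
  assumes "has_diagram K X"
    and "is_tree K"
    and "vertex_order K vs"
  shows "(\<forall>z. eigenvalue (map_mat complex_of_int (coxeter_transformation K vs)) z \<longrightarrow>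
            (\<exists>m > 0. z ^ m = 1)) \<and>
    (X = tE6 \<longrightarrow> eigenvalue_mset (coxeter_transformation K vs) =
       {#1, 1, cis (2 * pi / 3), cis (- (2 * pi / 3)), cis (2 * pi / 3), cis (- (2 * pi / 3)), - 1#}) \<and>
    (X = tE7 \<longrightarrow> eigenvalue_mset (coxeter_transformation K vs) =
       {#1, 1, cis (2 * pi / 3), cis (- (2 * pi / 3)), cis (pi / 2), cis (- (pi / 2)), - 1, - 1#}) \<and>
    (X = tE8 \<longrightarrow> eigenvalue_mset (coxeter_transformation K vs) =
       {#1, 1, cis (2 * pi / 3), cis (- (2 * pi / 3)), cis (2 * pi / 5), cis (- (2 * pi / 5)),
         cis (4 * pi / 5), cis (- (4 * pi / 5)), - 1#}) \<and>
    (\<forall>n. X = tD n \<longrightarrow> eigenvalue_mset (coxeter_transformation K vs) =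
       {#1, 1#} + {#cis (2 * real s * pi / real (n - 2)). s \<in># mset_set {1..n - 3}#} + {#- 1, - 1#}) \<and>
    (X = tG21 \<or> X = tG22 \<longrightarrow> eigenvalue_mset (coxeter_transformation K vs) = {#1, 1, - 1#}) \<and>
    (X = tF41 \<or> X = tF42 \<longrightarrow> eigenvalue_mset (coxeter_transformation K vs) =
       {#1, 1, cis (2 * pi / 3), cis (- (2 * pi / 3)), - 1#}) \<and>
    (X = tA11 \<or> X = tA12 \<longrightarrow> eigenvalue_mset (coxeter_transformation K vs) = {#1, 1#}) \<and>
    (\<forall>n. X = tB n \<or> X = tC n \<or> X = tBC n \<longrightarrow> eigenvalue_mset (coxeter_transformation K vs) =
       {#1, 1#} + {#cis (2 * real s * pi / real n). s \<in># mset_set {1..n - 1}#}) \<and>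
    (\<forall>n. X = tCD n \<or> X = tDD n \<longrightarrow> eigenvalue_mset (coxeter_transformation K vs) =
       {#1, 1#} + {#cis (2 * real s * pi / real (n - 1)). s \<in># mset_set {1..n - 2}#} + {#- 1#})"
proof -
  let ?C = "coxeter_transformation K vs"
  have X: "X \<noteq> tA n" for n using assms(1,2) not_is_tree_diagram_tA by blast
  have r: "ext_dynkin_range X" using assms(1) by (simp add: has_diagram_def)
  have pos: "\<forall>p \<in> set (arms X). p > 0" using arms_pos[OF r] by blast
  define N where "N = num_vertices X"
  have C: "?C \<in> carrier_mat N N" using assms(1) by (simp add: has_diagram_def N_def)
  have char: "char_poly (map_mat complex_of_int ?C) = coxeter_poly (arms X)"
    using char_poly_coxeter_transformation[OF assms(1) X assms(3)]
    by (simp add: of_int_hom.char_poly_hom[OF C] map_poly_of_int_coxeter_poly)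
  have roots: "\<forall>z. eigenvalue (map_mat complex_of_int ?C) z \<longrightarrow> (\<exists>m > 0. z ^ m = 1)"
  proof (intro allI impI)
    fix z assume "eigenvalue (map_mat complex_of_int ?C) z"
    then have "poly (coxeter_poly (arms X)) z = 0"
      using eigenvalue_root_char_poly[of "map_mat complex_of_int ?C" N z] C char by simp
    then show "\<exists>m > 0. z ^ m = 1" by (rule root_coxeter_poly[OF pos])
  qed
  have mset: "eigenvalue_mset ?C = {#1, 1#} +
      (\<Sum>p\<leftarrow>arms X. {#cis (2 * real s * pi / real p). s \<in># mset_set {1..p - 1}#})"
    unfolding eigenvalue_mset_def char by (rule proots_coxeter_poly[OF pos])
  have sub: "n - 2 - 1 = n - 3" "n - 1 - 1 = n - 2" for n :: nat by simp_all
  have num: "real 2 = 2" "real 3 = 3" "real 4 = 4" "real 5 = 5"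
    "2 - 1 = (1 :: nat)" "3 - 1 = (2 :: nat)" "4 - 1 = (3 :: nat)" "5 - 1 = (4 :: nat)" by simp_all
  note arms = arms.simps list.map sum_list.Nil sum_list.Cons num sub proots_small
  show ?thesis
  proof (intro conjI)
    show "X = tE6 \<longrightarrow> eigenvalue_mset ?C =
       {#1, 1, cis (2 * pi / 3), cis (- (2 * pi / 3)), cis (2 * pi / 3), cis (- (2 * pi / 3)), - 1#}"
      unfolding mset by (intro impI) (simp only: arms, simp)
    show "X = tE7 \<longrightarrow> eigenvalue_mset ?C =
       {#1, 1, cis (2 * pi / 3), cis (- (2 * pi / 3)), cis (pi / 2), cis (- (pi / 2)), - 1, - 1#}"
      unfolding mset by (intro impI) (simp only: arms, simp)
    show "X = tE8 \<longrightarrow> eigenvalue_mset ?C =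
       {#1, 1, cis (2 * pi / 3), cis (- (2 * pi / 3)), cis (2 * pi / 5), cis (- (2 * pi / 5)),
         cis (4 * pi / 5), cis (- (4 * pi / 5)), - 1#}"
      unfolding mset by (intro impI) (simp only: arms, simp)
    show "\<forall>n. X = tD n \<longrightarrow> eigenvalue_mset ?C =
       {#1, 1#} + {#cis (2 * real s * pi / real (n - 2)). s \<in># mset_set {1..n - 3}#} + {#- 1, - 1#}"
      unfolding mset by (intro allI impI) (simp only: arms, simp)
    show "X = tG21 \<or> X = tG22 \<longrightarrow> eigenvalue_mset ?C = {#1, 1, - 1#}"
      unfolding mset by (elim disjE | intro impI | (simp only: arms, simp))+
    show "X = tF41 \<or> X = tF42 \<longrightarrow> eigenvalue_mset ?C =
       {#1, 1, cis (2 * pi / 3), cis (- (2 * pi / 3)), - 1#}"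
      unfolding mset by (elim disjE | intro impI | (simp only: arms, simp))+
    show "X = tA11 \<or> X = tA12 \<longrightarrow> eigenvalue_mset ?C = {#1, 1#}"
      unfolding mset by auto
    show "\<forall>n. X = tB n \<or> X = tC n \<or> X = tBC n \<longrightarrow> eigenvalue_mset ?C =
       {#1, 1#} + {#cis (2 * real s * pi / real n). s \<in># mset_set {1..n - 1}#}"
      unfolding mset by auto
    show "\<forall>n. X = tCD n \<or> X = tDD n \<longrightarrow> eigenvalue_mset ?C =
       {#1, 1#} + {#cis (2 * real s * pi / real (n - 1)). s \<in># mset_set {1..n - 2}#} + {#- 1#}"
      unfolding mset by (intro allI) (elim disjE | intro impI | (simp only: arms, simp))+
  qed (rule roots)
qed

end
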